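(* Let $\mathcal{C}=(1,c_2,c_3,c_4,c_5,c_6)$ be a coin system with integers $1<c_2<c_3<c_4<c_5<c_6$. Then $\mathcal{C}$ is orderly if and only if $\mathcal{C}$ is one of the following: \begin{enumerate} \item Coin systems with pattern $(++++-+)$: \begin{enumerate} \item $(1,2,3,a,a+1,2a)$, where $a\geq 5$; \item $(1,a,2a,b,b+a,2b)$, where $a\geq 2$, $b\geq 3a-1$, $b\neq 3a$, and $grd_{\mathcal{C}}(2ma)\leq m$ where $m=\lceil \frac{b}{2a}\rceil$; \item $(1,a,2a-1,b,b+a-1,2b-1)$, where $a\geq 2$, $b\geq 3a-1$, and $grd_{\mathcal{C}}(m'(2a-1))\leq m'$ where $m'=\lceil \frac{b}{2a-1}\rceil$. \end{enumerate} \item Coin systems with pattern $(+++--+)$: \begin{enumerate} \item $(1,a,2a-1,m(2a-1)-(a-1),m(2a-1),(2m-1)(2a-1))$, where $1<m<a$; \item $(1,a,2a,m(2a-1)-(a-1),m(2a-1)+1,(2m-1)(2a-1)+1)$, where $1<m\leq a$. \end{enumerate} \item Coin systems with pattern $(++++++)$ or $(+++-++)$: $(1,c_2,c_3,c_4,c_5)$ is orderly and $grd_{\mathcal{C}}(mc_5)\leq m$ where $m=\lceil \frac{c_6}{c_5}\rceil$. \end{enumerate}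
   Context: A coin system is a tuple $\mathcal{C}=(c_1,c_2,\ldots,c_n)$ of integers with $c_1=1<c_2<\cdots<c_n$; each coin value may be used any number of times. For a positive integer $v$, $opt_{\mathcal{C}}(v)$ is the minimum number of coins (with values in $\mathcal{C}$) summing to $v$, and $grd_{\mathcal{C}}(v)$ is the number of coins used by the greedy algorithm: repeatedly take as many coins as possible of the largest coin value not exceeding the remaining amount, then move to the next smaller value, until the total is $v$. $\mathcal{C}$ is orderly if $grd_{\mathcal{C}}(v)=opt_{\mathcal{C}}(v)$ for all $v>0$. The prefix coin system of length $i$ is $(1,c_2,\ldots,c_i)$. The pattern of $\mathcal{C}$ is the string of $n$ symbols whose $i$-th symbol is $+$ if the prefix coin system of length $i$ is orderly and $-$ otherwise. *)

theory Defs
  imports Complex_Main "HOL-Library.Multiset"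
begin

definition coin_system :: "nat list \<Rightarrow> bool" where
  "coin_system C \<longleftrightarrow> C \<noteq> [] \<and> hd C = 1 \<and> sorted_wrt (<) C"

text \<open>A payment of \<open>v\<close> is a multiset of coins with sum \<open>v\<close>. One always exists when \<open>1\<close> is
  among the coin values, so the \<open>LEAST\<close> below is attained for every coin system.\<close>

definition opt :: "nat list \<Rightarrow> nat \<Rightarrow> nat" where
  "opt C v = (LEAST k. \<exists>M. set_mset M \<subseteq> set C \<and> sum_mset M = v \<and> size M = k)"

text \<open>Number of coins taken greedily from a list of values in decreasing order: a coin \<open>c\<close>
  is used \<open>v div c\<close> times (zero times if \<open>c\<close> exceeds \<open>v\<close>), leaving \<open>v mod c\<close>.\<close>

fun grd_desc :: "nat list \<Rightarrow> nat \<Rightarrow> nat" where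
  "grd_desc [] v = 0"
| "grd_desc (c # cs) v = v div c + grd_desc cs (v mod c)"

definition grd :: "nat list \<Rightarrow> nat \<Rightarrow> nat" where
  "grd C v = grd_desc (rev C) v"

definition orderly :: "nat list \<Rightarrow> bool" where
  "orderly C \<longleftrightarrow> (\<forall>v>0. grd C v = opt C v)"

definition pattern :: "nat list \<Rightarrow> string" where
  "pattern C = map (\<lambda>i. if orderly (take i C) then CHR ''+'' else CHR ''-'') [1..<length C + 1]"

end

(*
  A coin system is orderly iff adding one coin to an amount raises the greedy count by at most one.
  This criterion yields the one-point theorem (a system whose longest proper prefix is orderly is
  tested on a single multiple of the second largest coin) and the Kozen-Zaks bound on the smallest
  counterexample.

  Necessity: if (1,a,b,c,d,e) is orderly but (1,a,b,c,d) is not, the Kozen-Zaks bound gives e < c + d,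
  so the greedy payments of c + d and 2d are c + d = e + u and 2d = e + w for coins u < w. Examining
  the sums of two coins leaves only (u,w) = (1,a) and (a,b), which are the families of case 1.

  Sufficiency: in the doubling families c is followed by c + (b - a) and 2c + b - 2a with b in
  {2a - 1, 2a}, and all cases of the criterion reduce to the inequalities i <= g(c + i - a) and
  i <= g(c + i - b) for small i, where g is the greedy count for (1,a,b); both follow from the
  condition on the multiple of b. The families of case 2 are exactly the members of the doubling
  families for which (1,a,b,c) fails the one-point test.
*)
theory Submission
  imports Defs
begin

section \<open>The exchange criterion\<close>

lemma grd_snoc: "grd (C @ [c]) v = v div c + grd C (v mod c)"
  by (simp add: grd_def)

lemma grd_snoc_less: "v < c \<Longrightarrow> grd (C @ [c]) v = grd C v"
  by (simp add: grd_snoc)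

lemma grd_snoc_ge:
  assumes "c > 0" "c \<le> v"
  shows "grd (C @ [c]) v = Suc (grd (C @ [c]) (v - c))"
  using assms by (simp add: grd_snoc le_div_geq le_mod_geq)

lemma grd_0 [simp]: "grd C 0 = 0"
  by (induction C rule: rev_induct) (simp_all add: grd_snoc, simp add: grd_def)

text \<open>The greedy count belongs to an actual payment: since the last coin is 1, the final
  remainder is paid in full.\<close>

lemma grd_desc_payment:
  assumes "ds \<noteq> []" "last ds = 1"
  shows "\<exists>M. set_mset M \<subseteq> set ds \<and> sum_mset M = v \<and> size M = grd_desc ds v"
  using assms
proof (induction ds arbitrary: v)
  case (Cons c cs)
  show ?case
  proof (cases "cs = []")
    case True
    with Cons.prems show ?thesis
      by (intro exI[of _ "replicate_mset v 1"]) auto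
  next
    case False
    with Cons obtain M where M: "set_mset M \<subseteq> set cs" "sum_mset M = v mod c"
      "size M = grd_desc cs (v mod c)"
      by (metis last_ConsR)
    show ?thesis
    proof (intro exI conjI)
      show "set_mset (replicate_mset (v div c) c + M) \<subseteq> set (c # cs)"
        using M(1) by auto
    qed (simp_all add: M)
  qed
qed simp

lemma grd_payment:
  assumes "coin_system C"
  obtains M where "set_mset M \<subseteq> set C" "sum_mset M = v" "size M = grd C v"
  using grd_desc_payment[of "rev C" v] assms
  by (auto simp: coin_system_def grd_def last_rev)

lemma opt_le_size: "set_mset M \<subseteq> set C \<Longrightarrow> sum_mset M = v \<Longrightarrow> opt C v \<le> size M"
  unfolding opt_def by (rule Least_le) blast

lemma opt_payment:
  assumes "coin_system C"
  obtains M where "set_mset M \<subseteq> set C" "sum_mset M = v" "size M = opt C v"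
proof -
  obtain M where "set_mset M \<subseteq> set C" "sum_mset M = v" "size M = grd C v"
    using grd_payment[OF assms] .
  then have "\<exists>k. \<exists>M. set_mset M \<subseteq> set C \<and> sum_mset M = v \<and> size M = k"
    by blast
  from LeastI_ex[OF this] that show ?thesis
    unfolding opt_def by blast
qed

text \<open>If greedy is optimal, adding \<open>c\<close> to a greedy payment of \<open>v\<close>
  pays \<open>v + c\<close> with one coin more, which bounds \<open>grd C (v + c)\<close>.
  Conversely, building any payment up coin by coin shows that greedy never needs more coins than
  that payment.\<close>

lemma orderly_iff_grd_add:
  assumes "coin_system C"
  shows "orderly C \<longleftrightarrow> (\<forall>v. \<forall>c\<in>set C. grd C (v + c) \<le> Suc (grd C v))"
proof
  assume ord: "orderly C"
  show "\<forall>v. \<forall>c\<in>set C. grd C (v + c) \<le> Suc (grd C v)"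
  proof (intro allI ballI)
    fix v c assume c: "c \<in> set C"
    obtain M where M: "set_mset M \<subseteq> set C" "sum_mset M = v" "size M = grd C v"
      using grd_payment[OF assms] .
    then have "opt C (v + c) \<le> size (add_mset c M)"
      using c by (intro opt_le_size) auto
    then show "grd C (v + c) \<le> Suc (grd C v)"
      \<comment> \<open>\<open>orderly\<close> speaks only of positive amounts, so the amount 0 is
        split off.\<close>
      using ord M by (cases "v + c = 0") (auto simp: orderly_def)
  qed
next
  assume sub: "\<forall>v. \<forall>c\<in>set C. grd C (v + c) \<le> Suc (grd C v)"
  have le: "grd C (sum_mset M) \<le> size M" if "set_mset M \<subseteq> set C" for M
    using that
  proof (induction M)
    case (add c M)
    then have "grd C (sum_mset M + c) \<le> Suc (grd C (sum_mset M))" "grd C (sum_mset M) \<le> size M"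
      using sub by simp_all
    then show ?case by (simp add: add.commute)
  qed simp
  show "orderly C"
    unfolding orderly_def
  proof (intro allI impI antisym)
    fix v
    show "grd C v \<le> opt C v"
      using opt_payment[OF assms, of v] le by metis
    show "opt C v \<le> grd C v"
      using grd_payment[OF assms, of v] opt_le_size by metis
  qed
qed

lemma coin_system_snocD:
  assumes "coin_system (C @ [c])" "C \<noteq> []"
  shows "coin_system C" "\<And>x. x \<in> set C \<Longrightarrow> 0 < x \<and> x < c"
proof -
  show C: "coin_system C"
    using assms by (auto simp: coin_system_def sorted_wrt_append)
  fix x assume "x \<in> set C"
  moreover have "hd C \<le> x"
    using C \<open>x \<in> set C\<close> by (cases C) (auto simp: coin_system_def)
  ultimately show "0 < x \<and> x < c"
    using assms by (auto simp: coin_system_def sorted_wrt_append)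
qed

text \<open>The first greedy step for a coin in any position of the list: larger coins exceed
  \<open>v\<close> and are skipped.\<close>

lemma grd_top:
  assumes "sorted_wrt (<) C" "c \<in> set C" "0 < c" "c \<le> v"
    and "\<And>x. x \<in> set C \<Longrightarrow> x \<le> v \<Longrightarrow> x \<le> c"
  shows "grd C v = Suc (grd C (v - c))"
  using assms
proof (induction C rule: rev_induct)
  case (snoc x C)
  show ?case
  proof (cases "c = x")
    case True
    then show ?thesis using snoc.prems grd_snoc_ge by blast
  next
    case False
    then have "c \<in> set C" "c < x"
      using snoc.prems by (auto simp: sorted_wrt_append)
    moreover from this have "v < x"
      using snoc.prems(5)[of x] by force
    moreover have "grd C v = Suc (grd C (v - c))"
      using snoc.prems \<open>c \<in> set C\<close> by (intro snoc.IH) (simp_all add: sorted_wrt_append)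
    ultimately show ?thesis
      by (simp add: grd_snoc_less)
  qed
qed simp

lemma coin_pos: "coin_system C \<Longrightarrow> c \<in> set C \<Longrightarrow> 0 < c"
  by (cases C) (auto simp: coin_system_def)

lemma grd_coin:
  assumes "coin_system C" "c \<in> set C"
  shows "grd C c = 1"
  using grd_top[of C c c] assms coin_pos[OF assms] by (simp add: coin_system_def)

lemma grd_le_1D:
  assumes "coin_system C" "grd C v \<le> 1"
  shows "v = 0 \<or> v \<in> set C"
proof -
  obtain M where M: "set_mset M \<subseteq> set C" "sum_mset M = v" "size M = grd C v"
    using grd_payment[OF assms(1)] .
  with assms(2) have "size M = 0 \<or> size M = 1" by linarith
  then have "M = {#} \<or> (\<exists>x. M = {#x#})"
    using size_1_singleton_mset size_eq_0_iff_empty by blast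
  with M show ?thesis by auto
qed

text \<open>Greedy pays \<open>p + q\<close> with at most two coins. Its first coin is
  \<open>c\<close>, so what remains is 0 or a single coin. The equations between coins in the
  necessity proofs come from here.\<close>

lemma orderly_two_coins:
  assumes "coin_system C" "orderly C" "p \<in> set C" "q \<in> set C"
    and "c \<in> set C" "c \<le> p + q" "\<forall>x\<in>set C. x \<le> p + q \<longrightarrow> x \<le> c"
  shows "\<exists>x\<in>insert 0 (set C). p + q = c + x"
proof -
  have "grd C (p + q) \<le> Suc (grd C p)"
    using assms(1-4) orderly_iff_grd_add by blast
  moreover have "grd C (p + q) = Suc (grd C (p + q - c))"
    using assms coin_pos[OF assms(1,5)] by (intro grd_top) (auto simp: coin_system_def)
  ultimately have "p + q - c = 0 \<or> p + q - c \<in> set C"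
    using grd_coin[OF assms(1,3)] by (intro grd_le_1D[OF assms(1)]) simp
  then show ?thesis
    using assms(6) by (intro bexI[of _ "p + q - c"]) auto
qed

lemma grd_append_less: "(\<And>x. x \<in> set E \<Longrightarrow> v < x) \<Longrightarrow> grd (C @ E) v = grd C v"
proof (induction E rule: rev_induct)
  case (snoc x E)
  then show ?case using grd_snoc_less[of v x "C @ E"] by simp
qed simp

text \<open>Kozen and Zaks: a smallest counterexample lies below the sum of the two largest coins.\<close>

lemma orderly_prefix_of_gap:
  assumes cs: "coin_system (C @ [c, d] @ E)" and ord: "orderly (C @ [c, d] @ E)"
    and gap: "\<And>e. e \<in> set E \<Longrightarrow> c + d \<le> e"
  shows "orderly (C @ [c, d])"
proof -
  let ?L = "C @ [c, d]"
  have L: "coin_system ?L"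
    using cs by (cases C) (auto simp: coin_system_def sorted_wrt_append)
  then have dpos: "0 < d"
    using coin_pos by simp
  have le_c: "x \<le> c" if "x \<in> set ?L" "x \<noteq> d" for x
    using that L by (auto simp: coin_system_def sorted_wrt_append intro: less_imp_le)
  have ge: "grd ?L v = Suc (grd ?L (v - d))" if "d \<le> v" for v
    using grd_snoc_ge[of d v "C @ [c]"] that dpos by simp
  have "grd ?L (v + x) \<le> Suc (grd ?L v)" if "x \<in> set ?L" for v x
    using that
  proof (induction v arbitrary: x rule: less_induct)
    case (less v)
    \<comment> \<open>Below \<open>c + d\<close> no coin of \<open>E\<close> is ever used, so the
      criterion is inherited from the whole system. From \<open>c + d\<close> on, a coin
      \<open>x\<close> other than \<open>d\<close> is at most \<open>c\<close>, hence
      \<open>d \<le> v\<close>; both greedy payments then start with \<open>d\<close> and induction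
      applies.\<close>
    consider "v + x < c + d" | "x = d" | "c + d \<le> v + x" "x \<noteq> d" by linarith
    then show ?case
    proof cases
      case 1
      then have "grd (?L @ E) (v + x) = grd ?L (v + x)" "grd (?L @ E) v = grd ?L v"
        using gap by (intro grd_append_less; fastforce)+
      moreover have "grd (?L @ E) (v + x) \<le> Suc (grd (?L @ E) v)"
        using orderly_iff_grd_add[OF cs] ord less.prems by fastforce
      ultimately show ?thesis by simp
    next
      case 2
      then show ?thesis using ge[of "v + x"] by simp
    next
      case 3
      then have "d \<le> v" using le_c[OF less.prems] by linarith
      then have "grd ?L (v + x) = Suc (grd ?L (v - d + x))" "grd ?L v = Suc (grd ?L (v - d))"
        using ge[of "v + x"] ge[of v] by simp_all
      moreover have "grd ?L (v - d + x) \<le> Suc (grd ?L (v - d))"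
        using less.IH[of "v - d"] less.prems \<open>d \<le> v\<close> dpos by simp
      ultimately show ?thesis by simp
    qed
  qed
  then show ?thesis using orderly_iff_grd_add[OF L] by blast
qed

text \<open>Amounts may be reduced modulo \<open>e\<close>. If \<open>r + x\<close> reaches
  \<open>e\<close>, the payment gains one coin \<open>e\<close>, which uses up the allowance of one
  in the criterion; hence \<open>wrap\<close> has no \<open>Suc\<close>.\<close>

lemma orderly_snocI:
  assumes cs: "coin_system (C @ [e])" "C \<noteq> []"
    and below: "\<And>r x. x \<in> set C \<Longrightarrow> r + x < e \<Longrightarrow> grd C (r + x) \<le> Suc (grd C r)"
    and wrap: "\<And>r x. x \<in> set C \<Longrightarrow> r < e \<Longrightarrow> e \<le> r + x \<Longrightarrow> grd C (r + x - e) \<le> grd C r"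
  shows "orderly (C @ [e])"
  unfolding orderly_iff_grd_add[OF cs(1)]
proof (intro allI ballI)
  fix v x assume x: "x \<in> set (C @ [e])"
  note lt = coin_system_snocD(2)[OF cs]
  have epos: "0 < e"
    using coin_pos[OF cs(1)] by simp
  show "grd (C @ [e]) (v + x) \<le> Suc (grd (C @ [e]) v)"
  proof (cases "x = e")
    case True
    then show ?thesis using epos by (simp add: grd_snoc)
  next
    case False
    then have "x \<in> set C" "x < e" using x lt by auto
    define q r where "q = v div e" and "r = v mod e"
    have v: "v = q * e + r" "r < e" using epos by (simp_all add: q_def r_def)
    show ?thesis
    proof (cases "r + x < e")
      case True
      then show ?thesis
        using v below[OF \<open>x \<in> set C\<close>, of r] by (simp add: grd_snoc add.assoc)
    next
      case False
      then have "v + x = (q + 1) * e + (r + x - e)" "r + x - e < e"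
        using v \<open>x < e\<close> by (simp_all add: algebra_simps)
      then have "grd (C @ [e]) (v + x) = q + 1 + grd C (r + x - e)"
        using epos by (simp only: grd_snoc div_mult_self3 mod_mult_self3) simp
      then show ?thesis
        using v wrap[OF \<open>x \<in> set C\<close> \<open>r < e\<close>] False epos by (simp add: grd_snoc)
    qed
  qed
qed

section \<open>Subadditivity of the greedy count and the one-point test\<close>

lemma orderly_grd_add:
  assumes "coin_system C" "orderly C"
  shows "grd C (u + v) \<le> grd C u + grd C v"
proof -
  obtain M where M: "set_mset M \<subseteq> set C" "sum_mset M = v" "size M = grd C v"
    using grd_payment[OF assms(1)] .
  have "grd C (u + sum_mset M) \<le> grd C u + size M"
    using M(1)
  proof (induction M)
    case (add c M)
    then have "grd C (u + sum_mset M + c) \<le> Suc (grd C (u + sum_mset M))"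
      using assms orderly_iff_grd_add[OF assms(1)] by (simp del: add.assoc)
    with add show ?case by (simp add: ac_simps)
  qed simp
  with M show ?thesis by simp
qed

lemma orderly_grd_mult:
  assumes "coin_system C" "orderly C" "c \<in> set C"
  shows "grd C (m * c) \<le> m"
proof (induction m)
  case (Suc m)
  moreover have "grd C (m * c + c) \<le> Suc (grd C (m * c))"
    using assms orderly_iff_grd_add by blast
  ultimately show ?case by (simp add: add.commute)
qed simp

text \<open>These two inequalities are all that is used of the real ceiling in the theorem.\<close>

lemma nat_ceiling_divide:
  fixes a b :: nat
  assumes "0 < a"
  defines "m \<equiv> nat \<lceil>real b / real a\<rceil>"
  shows "b \<le> m * a" "m * a < b + a"
proof -
  have m: "real b / real a \<le> real m" "real m < real b / real a + 1"
    unfolding m_def by (simp_all add: of_nat_nat) linarith+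
  then have "real b \<le> real m * real a" "real m * real a < real b + real a"
    using assms(1) by (simp_all add: field_simps)
  then show "b \<le> m * a" "m * a < b + a"
    by (metis of_nat_le_iff of_nat_mult, metis of_nat_less_iff of_nat_mult of_nat_add)
qed

text \<open>The one-point theorem of Magazine, Nemhauser and Trotter.\<close>

lemma orderly_snoc_one_point:
  assumes cs: "coin_system (C @ [d, e])" and ord: "orderly (C @ [d])"
    and m: "e \<le> m * d" "m * d < e + d" and pt: "grd (C @ [d]) (m * d - e) < m"
  shows "orderly (C @ [d, e])"
proof -
  let ?L = "C @ [d]"
  define k where "k = m * d - e"
  have L: "coin_system ?L" and lt: "\<And>x. x \<in> set ?L \<Longrightarrow> 0 < x \<and> x < e"
    using coin_system_snocD[of ?L e] cs by auto
  have dpos: "0 < d" and "d < e" using lt[of d] by auto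
  have le_d: "x \<le> d" if "x \<in> set ?L" for x
    using that L by (auto simp: coin_system_def sorted_wrt_append intro: less_imp_le)
  note add = orderly_grd_add[OF L ord]
  have mult: "grd ?L (q * d + t) = q + grd ?L t" for q t
    using dpos by (simp add: grd_snoc add.commute)
  \<comment> \<open>Taking \<open>e\<close> away from an amount saves at least one coin:
    \<open>m\<close> coins \<open>d\<close> amount to \<open>e + k\<close>, and \<open>k\<close>
    costs fewer than \<open>m\<close> coins. If \<open>x\<close> contains \<open>m\<close> coins
    \<open>d\<close>, these are exchanged directly; otherwise it contains exactly
    \<open>m - 1\<close>, and one coin \<open>d\<close> is first added to
    \<open>x - e\<close>.\<close>
  have drop: "Suc (grd ?L (x - e)) \<le> grd ?L x" if "e \<le> x" for x
  proof -
    define q t where "q = x div d" and "t = x mod d"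
    have x: "x = q * d + t" "t < d" using dpos by (simp_all add: q_def t_def)
    have kd: "m * d = e + k" "k < d" using m by (auto simp: k_def)
    have "m * d < (q + 2) * d"
      using kd x that by (simp add: algebra_simps)
    then have "m < q + 2" by (simp only: mult_less_cancel2)
    then have "m \<le> q + 1" by simp
    then consider n where "q = m + n" | "m = q + 1"
      by (metis le_Suc_eq le_iff_add add.commute plus_1_eq_Suc)
    then show ?thesis
    proof cases
      case 1
      then have "x - e = n * d + (t + k)"
        using x kd by (simp add: algebra_simps)
      then have "grd ?L (x - e) = n + grd ?L (t + k)" by (simp only: mult)
      moreover have "grd ?L x = q + grd ?L t" by (simp only: mult x)
      ultimately show ?thesis
        using add[of t k] pt 1 by (simp add: k_def)
    next
      case 2
      then have e: "d + (x - e) = t + k"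
        using x kd that by (simp add: algebra_simps)
      have "Suc (grd ?L (x - e)) = grd ?L (d + (x - e))"
        using mult[of 1 "x - e"] by simp
      also have "\<dots> \<le> grd ?L t + grd ?L k" unfolding e by (rule add)
      finally show ?thesis
        using mult[of q t] pt 2 by (simp add: k_def x)
    qed
  qed
  have "orderly (?L @ [e])"
  proof (rule orderly_snocI)
    show "coin_system (?L @ [e])" using cs by simp
    show "grd ?L (r + x) \<le> Suc (grd ?L r)" if "x \<in> set ?L" for r x
      using that ord orderly_iff_grd_add[OF L] by blast
    then show "grd ?L (r + x - e) \<le> grd ?L r" if "x \<in> set ?L" "e \<le> r + x" for r x
      using that drop[of "r + x"] by (meson Suc_le_mono le_trans)
  qed simp
  then show ?thesis by simp
qed

text \<open>The one-point test with \<open>m = 2\<close>: the remainder \<open>2 * d - e\<close>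
  costs at most one coin.\<close>

lemma orderly_snoc_double:
  assumes cs: "coin_system (C @ [d, e])" and ord: "orderly (C @ [d])"
    and "e \<le> 2 * d" "2 * d - e \<in> insert 0 (set (C @ [d]))"
  shows "orderly (C @ [d, e])"
proof -
  have L: "coin_system (C @ [d])" and "d < e"
    using coin_system_snocD[of "C @ [d]" e] cs by auto
  have "grd (C @ [d]) (2 * d - e) < 2"
    using assms(4) grd_coin[OF L] by force
  then show ?thesis
    using assms \<open>d < e\<close> by (intro orderly_snoc_one_point[of C d e 2]) auto
qed

text \<open>For the converse, greedy pays \<open>m * d\<close> by one coin \<open>e\<close> and then
  the remainder, and \<open>m\<close> coins \<open>d\<close> would also do.\<close>

lemma orderly_snoc_one_point_iff:
  assumes cs: "coin_system (C @ [d, e])" and ord: "orderly (C @ [d])"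
    and m: "e \<le> m * d" "m * d < e + d"
  shows "orderly (C @ [d, e]) \<longleftrightarrow> grd (C @ [d]) (m * d - e) < m"
proof
  assume o: "orderly (C @ [d, e])"
  have L: "coin_system (C @ [d])" and "d < e" "0 < d"
    using coin_system_snocD[of "C @ [d]" e] cs by auto
  have "grd (C @ [d, e]) (m * d) \<le> m"
    using orderly_grd_mult[OF cs o] by simp
  moreover have "grd (C @ [d, e]) (m * d) = Suc (grd (C @ [d]) (m * d - e))"
    using grd_snoc_ge[of e "m * d" "C @ [d]"] grd_snoc_less[of "m * d - e" e "C @ [d]"] m \<open>d < e\<close>
    by simp
  ultimately show "grd (C @ [d]) (m * d - e) < m" by simp
next
  assume "grd (C @ [d]) (m * d - e) < m"
  then show "orderly (C @ [d, e])"
    by (intro orderly_snoc_one_point[OF assms])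
qed

lemma orderly_iff_one_point:
  assumes cs: "coin_system (C @ [d, e])" and ord: "orderly (C @ [d])"
  defines "m \<equiv> nat \<lceil>real e / real d\<rceil>"
  shows "orderly (C @ [d, e]) \<longleftrightarrow> grd (C @ [d, e]) (m * d) \<le> m"
proof -
  have "0 < d" "d < e"
    using coin_system_snocD[of "C @ [d]" e] cs by auto
  note m = nat_ceiling_divide[OF \<open>0 < d\<close>, of e, folded m_def]
  have "grd (C @ [d, e]) (m * d) = Suc (grd (C @ [d]) (m * d - e))"
    using grd_snoc_ge[of e "m * d" "C @ [d]"] grd_snoc_less[of "m * d - e" e "C @ [d]"] m \<open>d < e\<close>
    by simp
  then show ?thesis
    using orderly_snoc_one_point_iff[OF cs ord m] by (simp add: Suc_le_eq)
qed

section \<open>Sums of two coins\<close>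

lemma orderly_1: "orderly [1]"
  by (subst orderly_iff_grd_add) (simp_all add: coin_system_def grd_def)

lemma orderly_1_2:
  assumes "1 < a"
  shows "orderly [1, a]"
proof -
  have "coin_system ([1] @ [a])" using assms by (simp add: coin_system_def)
  then have "orderly ([1] @ [a])"
  proof (rule orderly_snocI)
    fix r x assume "x \<in> set [1]" and r: "r < a" "a \<le> r + x"
    then have "r + x - a = 0" by simp
    then show "grd [1] (r + x - a) \<le> grd [1] r" by (simp del: diff_is_0_eq)
  qed (simp_all add: grd_def)
  then show ?thesis by simp
qed

text \<open>The parts are sorted by the first greedy coin of \<open>p + q\<close>; the premises
  locate the sum between two consecutive coins.\<close>

lemma two_coins6:
  assumes ord: "orderly [1, a, b, c, d, e]" and lt: "1 < a" "a < b" "b < c" "c < d" "d < e"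
    and pq: "p \<in> {1, a, b, c, d, e}" "q \<in> {1, a, b, c, d, e}"
  shows "e \<le> p + q \<Longrightarrow> p + q \<in> {e, e + 1, e + a, e + b, e + c, e + d, e + e}"
    and "d \<le> p + q \<Longrightarrow> p + q < e \<Longrightarrow> p + q \<in> {d, d + 1, d + a, d + b, d + c, d + d}"
    and "c \<le> p + q \<Longrightarrow> p + q < d \<Longrightarrow> p + q \<in> {c, c + 1, c + a, c + b, c + c}"
    and "b \<le> p + q \<Longrightarrow> p + q < c \<Longrightarrow> p + q \<in> {b, b + 1, b + a, b + b}"
proof -
  have cs: "coin_system [1, a, b, c, d, e]" using lt by (simp add: coin_system_def)
  show "p + q \<in> {e, e + 1, e + a, e + b, e + c, e + d, e + e}" if "e \<le> p + q"
    using orderly_two_coins[OF cs ord, of p q e] that lt pq by force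
  show "p + q \<in> {d, d + 1, d + a, d + b, d + c, d + d}" if "d \<le> p + q" "p + q < e"
    using orderly_two_coins[OF cs ord, of p q d] that lt pq by force
  show "p + q \<in> {c, c + 1, c + a, c + b, c + c}" if "c \<le> p + q" "p + q < d"
    using orderly_two_coins[OF cs ord, of p q c] that lt pq by force
  show "p + q \<in> {b, b + 1, b + a, b + b}" if "b \<le> p + q" "p + q < c"
    using orderly_two_coins[OF cs ord, of p q b] that lt pq by force
qed

lemma two_coins5:
  assumes ord: "orderly [1, a, b, c, d]" and lt: "1 < a" "a < b" "b < c" "c < d"
    and pq: "p \<in> {1, a, b, c, d}" "q \<in> {1, a, b, c, d}"
  shows "d \<le> p + q \<Longrightarrow> p + q \<in> {d, d + 1, d + a, d + b, d + c, d + d}"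
    and "c \<le> p + q \<Longrightarrow> p + q < d \<Longrightarrow> p + q \<in> {c, c + 1, c + a, c + b, c + c}"
    and "b \<le> p + q \<Longrightarrow> p + q < c \<Longrightarrow> p + q \<in> {b, b + 1, b + a, b + b}"
proof -
  have cs: "coin_system [1, a, b, c, d]" using lt by (simp add: coin_system_def)
  show "p + q \<in> {d, d + 1, d + a, d + b, d + c, d + d}" if "d \<le> p + q"
    using orderly_two_coins[OF cs ord, of p q d] that lt pq by force
  show "p + q \<in> {c, c + 1, c + a, c + b, c + c}" if "c \<le> p + q" "p + q < d"
    using orderly_two_coins[OF cs ord, of p q c] that lt pq by force
  show "p + q \<in> {b, b + 1, b + a, b + b}" if "b \<le> p + q" "p + q < c"
    using orderly_two_coins[OF cs ord, of p q b] that lt pq by force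
qed

lemma two_coins4:
  assumes ord: "orderly [1, a, b, c]" and lt: "1 < a" "a < b" "b < c"
    and pq: "p \<in> {1, a, b, c}" "q \<in> {1, a, b, c}"
  shows "c \<le> p + q \<Longrightarrow> p + q \<in> {c, c + 1, c + a, c + b, c + c}"
    and "b \<le> p + q \<Longrightarrow> p + q < c \<Longrightarrow> p + q \<in> {b, b + 1, b + a, b + b}"
proof -
  have cs: "coin_system [1, a, b, c]" using lt by (simp add: coin_system_def)
  show "p + q \<in> {c, c + 1, c + a, c + b, c + c}" if "c \<le> p + q"
    using orderly_two_coins[OF cs ord, of p q c] that lt pq by force
  show "p + q \<in> {b, b + 1, b + a, b + b}" if "b \<le> p + q" "p + q < c"
    using orderly_two_coins[OF cs ord, of p q b] that lt pq by force
qed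

section \<open>Tests at twice the second largest coin\<close>

lemma orderly4_double:
  assumes "orderly [1, a, b]" "1 < a" "a < b" "b < c" "2 * b \<in> {c, c + 1, c + a, c + b}"
  shows "orderly [1, a, b, c]"
  using orderly_snoc_double[of "[1, a]" b c] assms by (auto simp: coin_system_def)

lemma orderly5_double:
  assumes "orderly [1, a, b, c]" "1 < a" "a < b" "b < c" "c < d" "2 * c \<in> {d, d + 1, d + a, d + b, d + c}"
  shows "orderly [1, a, b, c, d]"
  using orderly_snoc_double[of "[1, a, b]" c d] assms by (auto simp: coin_system_def)

lemma orderly3_double:
  assumes "orderly [1, a, b]" "1 < a" "a < b" "b \<le> 2 * a"
  shows "2 * a \<le> b + 1"
proof -
  have "grd [1, a] (2 * a - b) < 2"
    using orderly_snoc_one_point_iff[of "[1]" a b 2] orderly_1_2[of a] assms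
    by (auto simp: coin_system_def)
  moreover have "2 * a - b < a" using assms by simp
  then have "grd [1, a] (2 * a - b) = 2 * a - b"
    by (simp add: grd_def)
  ultimately show ?thesis by simp
qed

lemma orderly3_doubleI:
  assumes "1 < a" "b = 2 * a \<or> b + 1 = 2 * a"
  shows "orderly [1, a, b]"
proof -
  have "2 * a - b = 0 \<or> 2 * a - b = 1" using assms by linarith
  then have "orderly ([] @ [1] @ [a, b])"
    using orderly_snoc_double[of "[1]" a b] orderly_1_2[of a] assms
    by (auto simp: coin_system_def)
  then show ?thesis by simp
qed

section \<open>Prefixes of length three\<close>

text \<open>The remainder \<open>m * a - b\<close> is smaller than \<open>a\<close> and is paid in
  ones, so the failed one-point test becomes an inequality between numbers.\<close>

lemma not_orderly3_one_point:
  assumes nord: "\<not> orderly [1, a, b]" and lt: "1 < a" "a < b" and m: "b \<le> m * a" "m * a < b + a"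
  shows "m \<le> m * a - b"
proof -
  have "\<not> grd [1, a] (m * a - b) < m"
    using orderly_snoc_one_point[of "[1]" a b m] nord orderly_1_2 lt m
    by (auto simp: coin_system_def)
  moreover have "m * a - b < a" using m by linarith
  then have "grd [1, a] (m * a - b) = m * a - b"
    by (simp add: grd_def)
  ultimately show ?thesis by simp
qed

lemma not_orderly3D:
  assumes nord: "\<not> orderly [1, a, b]" and lt: "1 < a" "a < b"
  shows "3 \<le> a" "b \<noteq> 2 * a" "b + 1 \<noteq> 2 * a"
proof -
  obtain m where m: "b \<le> m * a" "m * a < b + a"
    using nat_ceiling_divide[of a b] lt by auto
  note * = not_orderly3_one_point[OF nord lt]
  have "m \<noteq> 0" using m lt by (intro notI) simp
  moreover have "m \<noteq> 1" using m lt by (intro notI) simp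
  ultimately have "2 \<le> m" by linarith
  then have "b + 2 \<le> m * a"
    using *[OF m] m lt by linarith
  then show "3 \<le> a" using m by linarith
  show "b \<noteq> 2 * a" "b + 1 \<noteq> 2 * a"
    using *[of 2] lt by auto
qed

text \<open>The amount \<open>m * a\<close> at which (1,a,b) fails lies below \<open>a + b\<close>.
  Were \<open>c\<close> at least \<open>a + b\<close>, no later coin could repair that
  failure.\<close>

lemma not_orderly3_next_coin:
  assumes nord: "\<not> orderly [1, a, b]" and cs: "coin_system ([1, a, b, c] @ E)"
    and ord: "orderly ([1, a, b, c] @ E)"
  shows "c < a + b"
proof (rule ccontr)
  assume "\<not> c < a + b"
  have lt: "1 < a" "a < b" "b < c" and E: "\<And>x. x \<in> set E \<Longrightarrow> c < x"
    using cs by (auto simp: coin_system_def)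
  obtain m where m: "b \<le> m * a" "m * a < b + a"
    using nat_ceiling_divide[of a b] lt by auto
  have lt': "m * a < c" "m * a - b < a" using m \<open>\<not> c < a + b\<close> by linarith+
  have "grd ([1, a, b] @ c # E) (m * a) = grd [1, a, b] (m * a)"
    using lt' E by (intro grd_append_less) fastforce
  also have "\<dots> = Suc (grd [1, a] (m * a - b))"
    using grd_snoc_ge[of b "m * a" "[1, a]"] grd_snoc_less[of "m * a - b" b "[1, a]"] m lt by simp
  also have "grd [1, a] (m * a - b) = m * a - b"
    using lt' by (simp add: grd_def)
  finally show False
    using orderly_grd_mult[OF cs ord, of a m] not_orderly3_one_point[OF nord lt(1,2) m] by simp
qed

text \<open>The sum \<open>a + b\<close> forces \<open>c + 1 = a + b\<close>, and then
  \<open>2 * b\<close> can only be \<open>c + a\<close>. This means \<open>b + 1 = 2 * a\<close>,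
  for which (1,a,b) is orderly.\<close>

lemma orderly4_imp_orderly3:
  assumes ord: "orderly [1, a, b, c]" and lt: "1 < a" "a < b" "b < c"
  shows "orderly [1, a, b]"
proof (rule ccontr)
  assume nord: "\<not> orderly [1, a, b]"
  note n = not_orderly3D[OF nord lt(1,2)]
  have c: "c < a + b"
    using not_orderly3_next_coin[OF nord, of c "[]"] ord lt by (simp add: coin_system_def)
  note two = two_coins4[OF ord lt]
  have "a + b \<in> {c, c + 1, c + a, c + b, c + c}" using two(1)[of a b] c lt by auto
  then have "c + 1 = a + b" using c lt by auto
  moreover have "2 * b \<in> {c, c + 1, c + a, c + b, c + c}"
    using two(1)[of b b] c lt by (simp flip: mult_2)
  ultimately show False using n lt by auto
qed

text \<open>By the shorter case (1,a,b,c) fails as well, so the bound on the smallest counterexample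
  gives \<open>d < b + c\<close>. Each position of \<open>d\<close> relative to \<open>a + b\<close>
  and \<open>a + c\<close> is then refuted by sums of two coins.\<close>

lemma orderly5_imp_orderly3:
  assumes ord: "orderly [1, a, b, c, d]" and lt: "1 < a" "a < b" "b < c" "c < d"
  shows "orderly [1, a, b]"
proof (rule ccontr)
  assume nord: "\<not> orderly [1, a, b]"
  note n = not_orderly3D[OF nord lt(1,2)]
  have cs: "coin_system [1, a, b, c, d]" using lt by (simp add: coin_system_def)
  have c: "c < a + b"
    using not_orderly3_next_coin[OF nord, of c "[d]"] ord cs by simp
  have "\<not> orderly [1, a, b, c]"
    using orderly4_imp_orderly3 nord lt by blast
  then have gap: "d < b + c"
    using orderly_prefix_of_gap[of "[1, a]" b c "[d]"] cs ord by force
  note two = two_coins5[OF ord lt]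
  have bc: "b + c \<in> {d, d + 1, d + a, d + b, d + c, d + d}"
    using two(1)[of b c] gap by simp
  have ac: "a + c \<in> {d, d + 1, d + a, d + b, d + c, d + d}" if "d \<le> a + c"
    using two(1)[of a c] that by simp
  show False
  proof (cases "d \<le> a + b")
    case True
    then have "a + c = d + 1" using ac lt by auto
    then have "c = b + 1" "d = a + b" using True lt by linarith+
    then show False using bc n lt by auto
  next
    case False
    then have "a + b \<in> {c, c + 1, c + a, c + b, c + c}"
      using two(2)[of a b] c by simp
    then have c: "c + 1 = a + b" using c lt by auto
    have ad: "d = a + c" if "d \<le> a + c"
      using ac[OF that] bc c n lt by auto
    show False
    proof (cases "d \<le> a + c")
      case True
      then have "d = a + c" by (rule ad)
      then have eqs: "b = a + 1" "c = 2 * a" "d = 3 * a" using bc c n lt by auto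
      then have "2 * b \<in> {c, c + 1, c + a, c + b, c + c}"
        using two(2)[of b b] n by (simp flip: mult_2)
      then show False using eqs n by auto
    next
      case False
      then have "d + 1 = b + c \<or> d + a = b + c" using bc gap lt by auto
      then show False
      proof
        assume d: "d + 1 = b + c"
        then have "c \<le> 2 * b" "2 * b < d" using c n lt by linarith+
        then have "2 * b \<in> {c, c + 1, c + a, c + b, c + c}"
          using two(2)[of b b] by (simp flip: mult_2)
        then show False using c n lt by auto
      next
        assume d: "d + a = b + c"
        then have "d \<le> 2 * c" using lt by linarith
        then have "2 * c \<in> {d, d + 1, d + a, d + b, d + c, d + d}"
          using two(1)[of c c] by (simp flip: mult_2)
        then show False using c d n lt by auto
      qed
    qed
  qed
qed

text \<open>Both shorter cases apply, so the bound on the smallest counterexample holds twice, as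
  \<open>d < b + c\<close> and \<open>e < c + d\<close>, in addition to
  \<open>c < a + b\<close>.\<close>

lemma orderly6_imp_orderly3:
  assumes ord: "orderly [1, a, b, c, d, e]" and lt: "1 < a" "a < b" "b < c" "c < d" "d < e"
  shows "orderly [1, a, b]"
proof (rule ccontr)
  assume nord: "\<not> orderly [1, a, b]"
  note n = not_orderly3D[OF nord lt(1,2)]
  have cs: "coin_system [1, a, b, c, d, e]" using lt by (simp add: coin_system_def)
  have c: "c < a + b"
    using not_orderly3_next_coin[OF nord, of c "[d, e]"] ord cs by simp
  have "\<not> orderly [1, a, b, c, d]"
    using orderly5_imp_orderly3 nord lt by blast
  then have gap: "e < c + d"
    using orderly_prefix_of_gap[of "[1, a, b]" c d "[e]"] cs ord by force
  have "\<not> orderly [1, a, b, c]"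
    using orderly4_imp_orderly3 nord lt by blast
  then have gap4: "d < b + c"
    using orderly_prefix_of_gap[of "[1, a]" b c "[d, e]"] cs ord lt by force
  note two = two_coins6[OF ord lt]
  have cd: "c + d \<in> {e + 1, e + a, e + b}"
    using two(1)[of c d] gap lt by auto
  have bd: "b + d \<in> {e, e + 1, e + a}" if "e \<le> b + d"
    using two(1)[of b d] that lt by auto
  have ad: "a + d \<in> {e, e + 1}" if "e \<le> a + d"
    using two(1)[of a d] that lt by auto
  have ge: "a + d \<le> e"
  proof (rule ccontr)
    assume "\<not> a + d \<le> e"
    then have "a + d = e + 1" using ad by auto
    then show False using bd n lt by auto
  qed
  show False
  proof (cases "d \<le> a + b")
    case True
    then have "d \<le> a + c" "a + c < e" using ge lt by linarith+
    then have "a + c = d + 1" using two(2)[of a c] True lt by auto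
    then have "c = b + 1" "d = a + b" using True lt by linarith+
    then have e: "e = a + 2 * b" using bd cd ge gap n lt by auto
    have "b + c \<in> {d, d + 1, d + a, d + b, d + c, d + d}"
      using two(2)[of b c] \<open>c = b + 1\<close> \<open>d = a + b\<close> e n lt by auto
    then show False using \<open>c = b + 1\<close> \<open>d = a + b\<close> n lt by auto
  next
    case False
    then have "a + b \<in> {c, c + 1, c + a, c + b, c + c}"
      using two(3)[of a b] c by simp
    then have c: "c + 1 = a + b" using c lt by auto
    have "d \<le> 2 * b"
    proof (rule ccontr)
      assume "\<not> d \<le> 2 * b"
      then have "2 * b \<in> {c, c + 1, c + a, c + b, c + c}"
        using two(3)[of b b] c lt by (simp flip: mult_2)
      then show False using c n lt by auto
    qed
    have dd: "2 * d \<in> {e, e + 1, e + a, e + b, e + c}"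
      using two(1)[of d d] gap lt by auto
    have "e + 1 = b + d \<or> e + 2 = a + b + d"
      using bd cd c ge gap n lt by auto
    then show False
    proof
      assume e: "e + 1 = b + d"
      then have d: "d + 1 = 2 * b" using dd c \<open>d \<le> 2 * b\<close> n lt by auto
      have "2 * a < b"
      proof (rule ccontr)
        assume "\<not> 2 * a < b"
        then have "d \<le> a + c" "a + c < e" using c d e lt by linarith+
        then have "a + c \<in> {d, d + 1, d + a, d + b, d + c, d + d}"
          using two(2)[of a c] by simp
        then show False using c d n lt by auto
      qed
      then have "2 * c \<in> {d, d + 1, d + a, d + b, d + c, d + d}"
        using two(2)[of c c] c d e n lt by (simp flip: mult_2)
      then show False using \<open>2 * a < b\<close> c d n lt by auto
    next
      assume e: "e + 2 = a + b + d"
      then have d: "d + 2 = 2 * a + b" using dd c \<open>d \<le> 2 * b\<close> n lt by auto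
      have "b + c \<in> {d, d + 1, d + a, d + b, d + c, d + d}"
        using two(2)[of b c] c d e n lt by auto
      then show False using c d n lt by auto
    qed
  qed
qed

section \<open>Orderly systems whose prefix of length five is not orderly\<close>

text \<open>An exceptional candidate for the first five coins in the necessity proof. It is checked
  with the closed form \<open>G\<close> of the greedy count below \<open>2 * b\<close>, where at
  most one of the coins \<open>b\<close> and \<open>b + 1\<close> is used, and only once.\<close>

lemma orderly_1_2_b_2b:
  assumes "3 \<le> b"
  shows "orderly [1, 2, b, b + 1, 2 * b]"
proof -
  let ?C = "[1, 2, b, b + 1]"
  have cs: "coin_system (?C @ [2 * b])" using assms by (simp add: coin_system_def)
  define G where "G = grd ?C"
  have G: "G v = (if v < b then (v + 1) div 2 else if v = b then 1 else Suc ((v - b) div 2))"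
    if "v < 2 * b" for v
  proof -
    have "grd [1, 2] u = (u + 1) div 2" for u
      by (simp add: grd_def) presburger
    then have *: "grd [1, 2, b] u = (if u < b then (u + 1) div 2 else Suc ((u - b + 1) div 2))" if "u < 2 * b" for u
      using grd_snoc_less[of u b "[1, 2]"] grd_snoc_ge[of b u "[1, 2]"] grd_snoc_less[of "u - b" b "[1, 2]"] that
      by (auto simp: assms)
    show ?thesis
      using grd_snoc_less[of v "b + 1" "[1, 2, b]"] grd_snoc_ge[of "b + 1" v "[1, 2, b]"]
        grd_snoc_less[of "v - (b + 1)" "b + 1" "[1, 2, b]"] *[of v] *[of "v - (b + 1)"] that
      by (auto simp: G_def Suc_diff_Suc)
  qed
  have "orderly (?C @ [2 * b])"
  proof (rule orderly_snocI[OF cs])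
    fix r x assume x: "x \<in> set ?C"
    have "G (r + x) \<le> Suc (G r)" if "r + x < 2 * b"
      using x that assms by (auto simp: G)
    then show "grd ?C (r + x) \<le> Suc (grd ?C r)" if "r + x < 2 * b"
      using that by (simp only: G_def)
    have "G (r + x - 2 * b) \<le> G r" if "r < 2 * b" "2 * b \<le> r + x"
      using x that assms by (auto simp: G)
    then show "grd ?C (r + x - 2 * b) \<le> grd ?C r" if "r < 2 * b" "2 * b \<le> r + x"
      using that by (simp only: G_def)
  qed simp
  then show ?thesis by simp
qed

lemma orderly6_necessary:
  assumes lt: "1 < a" "a < b" "b < c" "c < d" "d < e"
    and ord: "orderly [1, a, b, c, d, e]" and ord3: "orderly [1, a, b]"
    and nord5: "\<not> orderly [1, a, b, c, d]"
  shows "a = 2 \<and> b = 3 \<and> 5 \<le> c \<and> d = c + 1 \<and> e = 2 * c \<or>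
     b = 2 * a \<and> 3 * a \<le> c + 1 \<and> c \<noteq> 3 * a \<and> d = c + a \<and> e = 2 * c \<or>
     b + 1 = 2 * a \<and> 3 * a \<le> c + 1 \<and> d + 1 = c + a \<and> e + 1 = 2 * c"
proof -
  have cs: "coin_system [1, a, b, c, d, e]" using lt by (simp add: coin_system_def)
  have gap: "e < c + d"
    using orderly_prefix_of_gap[of "[1, a, b]" c d "[e]"] cs ord nord5 by force
  note two = two_coins6[OF ord lt]
  note ord4 = orderly4_double[OF ord3 lt(1-3)]
  have nord4: "2 * c \<in> {d, d + 1, d + a, d + b, d + c} \<Longrightarrow> \<not> orderly [1, a, b, c]"
    using orderly5_double lt nord5 by blast
  have gap4: "\<not> orderly [1, a, b, c] \<Longrightarrow> d < b + c"
    using orderly_prefix_of_gap[of "[1, a]" b c "[d, e]"] cs ord lt by force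
  \<comment> \<open>If both doubles fitted, two doubling steps would lead from (1,a,b) to an orderly
    (1,a,b,c,d).\<close>
  have not_both: "2 * b \<notin> {c, c + 1, c + a, c + b} \<or> 2 * c \<notin> {d, d + 1, d + a, d + b, d + c}"
    using ord4 nord4 by blast
  note ab = orderly3_double[OF ord3 lt(1,2)]
  \<comment> \<open>Cases 2 and 4 below both end in this candidate.\<close>
  have not12: "\<not> (a = 2 \<and> c = b + 1 \<and> d = 2 * b)"
    using orderly_1_2_b_2b[of b] nord5 lt by auto
  have "c + d \<in> {e + 1, e + a, e + b, e + c, e + d}"
    using two(1)[of c d] gap lt by auto
  moreover have "2 * d \<in> {e, e + 1, e + a, e + b, e + c}"
    using two(1)[of d d] gap lt by auto
  \<comment> \<open>With \<open>c + d = e + u\<close> and \<open>2 * d = e + w\<close>, the cases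
    are (u,w) = (1,c), (a,c), (b,c), (1,b), (a,b), (1,a), in this order. The difference of the sums
    is \<open>d - c\<close>, so \<open>u < w\<close>.\<close>
  ultimately consider (1) "c + d = e + 1" "2 * d = e + c"
    | (2) "c + d = e + a" "2 * d = e + c" | (3) "c + d = e + b" "2 * d = e + c"
    | (4) "c + d = e + 1" "2 * d = e + b" | (5) "c + d = e + a" "2 * d = e + b"
    | (6) "c + d = e + 1" "2 * d = e + a"
    using lt by auto
  then show ?thesis
  proof cases
    case 1
    then have "2 * c = d + 1" using lt by linarith
    then show ?thesis using gap4 nord4 1 lt by auto
  next
    case 2
    then have "2 * c = d + a" using lt by linarith
    then have "d < b + c" and b: "2 * b \<notin> {c, c + 1, c + a, c + b}"
      using gap4 nord4 ord4 by auto
    then have "c \<le> 2 * b" "2 * b \<noteq> c + c" using 2 ab lt by linarith+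
    with b have "\<not> 2 * b < d" using two(3)[of b b] by (auto simp flip: mult_2)
    moreover have "2 * b < e" using 2 lt ab by linarith
    ultimately have "2 * b \<in> {d, d + 1, d + a, d + b, d + c, d + d}"
      using two(2)[of b b] by (auto simp flip: mult_2)
    then have "2 * b = d \<or> 2 * b = d + 1" using 2 lt by auto
    moreover have "a + b < d \<Longrightarrow> c \<le> a + b \<Longrightarrow> a + b \<in> {c, c + 1, c + a, c + b, c + c}"
      using two(3)[of a b] by simp
    moreover have "\<not> d \<le> a + b"
      using calculation(1) 2 lt ab \<open>2 * c = d + a\<close> by linarith
    moreover have "c \<le> a + b"
      using calculation(1) 2 lt ab \<open>2 * c = d + a\<close> by linarith
    ultimately have "a + b \<in> {c, c + 1, c + a, c + b, c + c}" by simp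
    then have "a = 2 \<and> c = b + 1 \<and> d = 2 * b"
      using \<open>2 * b = d \<or> 2 * b = d + 1\<close> \<open>2 * c = d + a\<close> lt by auto
    then show ?thesis using not12 by blast
  next
    case 3
    then have "2 * c = d + b" using lt by linarith
    then have "d < b + c" and b: "2 * b \<notin> {c, c + 1, c + a, c + b}"
      using gap4 nord4 ord4 by auto
    then show ?thesis using two(1)[of d b] 3 lt by auto
  next
    case 4
    then have d: "d + 1 = b + c" by linarith
    then have "2 * c \<in> {d, d + 1, d + a, d + b, d + c, d + d}"
      using two(2)[of c c] 4 lt by (simp flip: mult_2)
    then have cc: "2 * c = d + a \<or> 2 * c = d + b"
      using d lt by auto
    then have b: "2 * b \<notin> {c, c + 1, c + a, c + b}"
      using not_both by auto
    then have c: "c + 1 = a + b"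
      using cc d by auto
    have "2 * b < d"
    proof (rule ccontr)
      assume "\<not> 2 * b < d"
      then have "a = 2" "c = b + 1" "d = 2 * b" using c d lt by linarith+
      then show False using not12 by blast
    qed
    moreover have "c \<le> 2 * b" using c lt by linarith
    ultimately show ?thesis
      using two(3)[of b b] b lt by auto
  next
    case 5
    \<comment> \<open>These are the equations of the doubling families. It remains to show
      \<open>b = 2 * a\<close> or \<open>b + 1 = 2 * a\<close>, the lower bound on \<open>c\<close>,
      and the exclusion of \<open>c = 3 * a\<close> when \<open>b = 2 * a\<close>.\<close>
    then have d: "d + a = b + c" and e: "e + 2 * a = 2 * c + b" by linarith+
    have b: "b = 2 * a \<or> b + 1 = 2 * a"
    proof (rule ccontr)
      assume "\<not> ?thesis"
      then have "2 * a < b" using ab by linarith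
      then have "2 * c \<in> {d, d + 1, d + a, d + b, d + c, d + d}"
        using two(2)[of c c] d e lt by (simp flip: mult_2)
      then have "2 * c = d + b" using \<open>2 * a < b\<close> d lt by auto
      then have "2 * b = c + a" using d by linarith
      then show False using not_both \<open>2 * c = d + b\<close> by auto
    qed
    have "\<not> c + 1 < 3 * a"
    proof
      assume c: "c + 1 < 3 * a"
      show False
      proof (cases "c = 2 * a")
        case True
        then have eqs: "b + 1 = 2 * a" "d + 1 = 3 * a" "e + 1 = 4 * a"
          using b d e lt by linarith+
        then have "2 * b \<in> {d, d + 1, d + a, d + b, d + c, d + d}"
          using two(2)[of b b] lt by (simp flip: mult_2)
        then have "a = 2" using eqs True lt by auto
        then show False using not_both eqs True by auto
      next
        case False
        then have "a + b \<in> {c, c + 1, c + a, c + b, c + c}"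
          using two(3)[of a b] b c d lt by auto
        then have "c + 2 = 3 * a \<and> b + 1 = 2 * a"
          using b c False lt by auto
        then show False using not_both d by auto
      qed
    qed
    \<comment> \<open>Here \<open>d = 4 * a\<close>, so \<open>2 * b = c + a\<close> and
      \<open>2 * c = d + b\<close> would both hold.\<close>
    moreover have "\<not> (b = 2 * a \<and> c = 3 * a)"
      using not_both d by auto
    ultimately show ?thesis using b d e by auto
  next
    case 6
    then have d: "d + 1 = c + a" and e: "e + 2 = 2 * c + a" by linarith+
    show ?thesis
    proof (cases "a = 2")
      case True
      then have "b + c \<in> {d, d + 1, d + a, d + b, d + c, d + d}"
        using two(2)[of b c] d e lt by auto
      then have "b = 3" using True d lt by auto
      \<comment> \<open>With \<open>c = 4\<close> and \<open>d = 5\<close> both doubles fit again: 6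
        = 4 + 2 and 8 = 5 + 3. This is the origin of the bound 5.\<close>
      moreover have "c \<noteq> 4"
        using not_both d True \<open>b = 3\<close> by auto
      ultimately show ?thesis using True d e lt by auto
    next
      case False
      then have "2 * c \<in> {d, d + 1, d + a, d + b, d + c, d + d}"
        using two(2)[of c c] d e lt by (simp flip: mult_2)
      then have c: "c + 1 = a + b"
        using ab d lt by auto
      have "d \<le> 2 * b" "2 * b < e" using ab c d e lt False by linarith+
      then have "2 * b \<in> {d, d + 1, d + a, d + b, d + c, d + d}"
        using two(2)[of b b] by (simp flip: mult_2)
      then have "b + 1 = 2 * a \<or> b + 2 = 3 * a"
        using ab c d lt by auto
      moreover have "b + 1 \<noteq> 2 * a"
        using not_both c d by auto
      moreover have False if "b + 2 = 3 * a"
      proof -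
        have "b + c \<in> {d, d + 1, d + a, d + b, d + c, d + d}"
          using two(2)[of b c] that c d e lt by simp
        then show False using that c d lt False by auto
      qed
      ultimately show ?thesis by blast
    qed
  qed
qed

section \<open>The doubling families\<close>

text \<open>This family is not a doubling family: with first coins 1, 2, 3 those end in
  \<open>2 * c - 1\<close>. The criterion is checked on the closed form \<open>G\<close> of the
  greedy count below \<open>2 * a\<close>.\<close>

lemma orderly_1_2_3_family:
  assumes "5 \<le> a"
  shows "orderly [1, 2, 3, a, a + 1, 2 * a]"
proof -
  let ?C = "[1, 2, 3, a, a + 1]"
  define G where "G = grd ?C"
  have cs: "coin_system (?C @ [2 * a])" using assms by (simp add: coin_system_def)
  have G: "G v = (if v < a then (v + 2) div 3 else if v = a then 1 else Suc ((v - a + 1) div 3))"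
    if "v < 2 * a" for v
  proof -
    have g: "grd [1, 2, 3] u = (u + 2) div 3" for u
    proof -
      define q t where "q = u div 3" and "t = u mod 3"
      have u: "u = t + 3 * q" by (simp add: q_def t_def)
      have "t < 3" by (simp add: t_def)
      then have "t = 0 \<or> t = 1 \<or> t = 2" by linarith
      then show ?thesis
        unfolding u by (auto simp: grd_def)
    qed
    have *: "grd [1, 2, 3, a] u = (if u < a then (u + 2) div 3 else Suc ((u - a + 2) div 3))" if "u < 2 * a" for u
      using grd_snoc_less[of u a "[1, 2, 3]"] grd_snoc_ge[of a u "[1, 2, 3]"] grd_snoc_less[of "u - a" a "[1, 2, 3]"]
        that assms g[of u] g[of "u - a"] by (auto simp del: One_nat_def)
    show ?thesis
      using grd_snoc_less[of v "a + 1" "[1, 2, 3, a]"] grd_snoc_ge[of "a + 1" v "[1, 2, 3, a]"]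
        grd_snoc_less[of "v - (a + 1)" "a + 1" "[1, 2, 3, a]"] *[of v] *[of "v - (a + 1)"] that
      by (auto simp: G_def Suc_diff_Suc)
  qed
  have "orderly (?C @ [2 * a])"
  proof (rule orderly_snocI[OF cs])
    fix r x assume x: "x \<in> set ?C"
    have "G (r + x) \<le> Suc (G r)" if "r + x < 2 * a"
      using x that assms by (auto simp: G)
    then show "grd ?C (r + x) \<le> Suc (grd ?C r)" if "r + x < 2 * a"
      using that by (simp only: G_def)
    have "G (r + x - 2 * a) \<le> G r" if "r < 2 * a" "2 * a \<le> r + x"
      using x that assms by (auto simp: G)
    then show "grd ?C (r + x - 2 * a) \<le> grd ?C r" if "r < 2 * a" "2 * a \<le> r + x"
      using that by (simp only: G_def)
  qed simp
  then show ?thesis by simp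
qed

text \<open>Below \<open>e\<close> the count \<open>G\<close> has three branches: \<open>g v\<close>
  below \<open>c\<close>, \<open>1 + (v - c)\<close> up to \<open>d\<close> because
  \<open>d - c = b - a\<close> is at most \<open>a\<close>, and \<open>1 + g (v - d)\<close> from
  \<open>d\<close> on because \<open>e - d = c - a\<close>. The criterion is verified branch by
  branch.\<close>

lemma orderly_doubling_family:
  assumes lt: "1 < a" "b < c" and b: "b = 2 * a \<or> b + 1 = 2 * a" and c: "3 * a \<le> c + 1"
    and d: "d + a = b + c" and e: "e + 2 * a = b + 2 * c"
    and m: "c \<le> m * b" "m * b < c + b" and pt: "grd [1, a, b, c, d, e] (m * b) \<le> m"
  shows "orderly [1, a, b, c, d, e]"
proof -
  have ab: "a < b" "c < d" "d < e" "d \<le> a + c" and be: "b + c \<le> e"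
    using lt b c d e by linarith+
  have o3: "orderly [1, a, b]"
    using orderly3_doubleI lt b by blast
  have cs3: "coin_system [1, a, b]" and cs: "coin_system ([1, a, b, c, d] @ [e])"
    using lt ab by (simp_all add: coin_system_def)
  define g where "g = grd [1, a, b]"
  define G where "G = grd [1, a, b, c, d]"
  have g_add: "g (v + x) \<le> Suc (g v)" if "x = 1 \<or> x = a" for v x
    using o3 orderly_iff_grd_add[OF cs3] that by (auto simp: g_def)
  have g_b: "g (v + b) = Suc (g v)" for v
    using grd_snoc_ge[of b "v + b" "[1, a]"] ab by (simp add: g_def)
  have g_mult: "g (k * b + v) = k + g v" for k v
  proof (induction k)
    case (Suc k)
    then show ?case using g_b[of "k * b + v"] by (simp add: ac_simps)
  qed simp
  have g_small: "g v = v" if "v < a" for v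
    using that ab by (simp add: g_def grd_def)
  have g_mid: "g v + a = v + 1" if "a \<le> v" "v < b" for v
  proof -
    have "g v = grd [1, a] v"
      using grd_snoc_less[of v b "[1, a]"] that by (simp add: g_def)
    also have "\<dots> = Suc (grd [1, a] (v - a))"
      using grd_snoc_ge[of a v "[1]"] that lt by simp
    finally have "g v = Suc (grd [1, a] (v - a))" .
    moreover have "v - a < a" using that b by linarith
    then have "grd [1, a] (v - a) = v - a"
      by (simp add: grd_def)
    ultimately show ?thesis using that by simp
  qed
  \<comment> \<open>Adding a coin \<open>a\<close> to \<open>v + (b - a)\<close> gives
    \<open>v + b\<close>, which costs exactly \<open>1 + g v\<close>.\<close>
  have g_shift: "g v \<le> g (v + (b - a))" for v
    using g_add[of a "v + (b - a)"] g_b[of v] ab by (simp add: add.assoc)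
  have G_c: "G v = g v" if "v < c" for v
  proof -
    have "grd ([1, a, b] @ [c, d]) v = grd [1, a, b] v"
      using that ab by (intro grd_append_less) auto
    then show ?thesis by (simp add: G_def g_def)
  qed
  have G_cd: "G v = Suc (v - c)" if "c \<le> v" "v < d" for v
  proof -
    have "G v = grd [1, a, b, c] v"
      using that grd_snoc_less[of v d "[1, a, b, c]"] by (simp add: G_def)
    also have "\<dots> = Suc (g (v - c))"
      using that grd_snoc_ge[of c v "[1, a, b]"] grd_snoc_less[of "v - c" c "[1, a, b]"] lt ab c
      by (simp add: g_def)
    finally show ?thesis using g_small[of "v - c"] that ab by simp
  qed
  have G_de: "G v = Suc (g (v - d))" if "d \<le> v" "v < e" for v
    using that grd_snoc_ge[of d v "[1, a, b, c]"] grd_snoc_less[of "v - d" d "[1, a, b, c]"]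
      G_c[of "v - d"] ab d e b
    by (auto simp: G_def)
  have g_le: "g v \<le> v" for v
  proof (induction v)
    case (Suc v)
    then show ?case using g_add[of 1 v] by simp
  qed (simp add: g_def)
  define \<delta> where "\<delta> = m * b - c"
  have mb: "m * b = c + \<delta>" "\<delta> < b" using m by (simp_all add: \<delta>_def)
  have "2 \<le> m"
  proof (rule ccontr)
    assume "\<not> 2 \<le> m"
    then have "m * b \<le> 1 * b" by (intro mult_le_mono1) simp
    then show False using m lt by linarith
  qed
  then obtain k where k: "m = k + 2" by (metis le_add_diff_inverse2)
  then have c': "c + \<delta> = (k + 2) * b" using mb by simp
  have "grd [1, a, b, c, d, e] (m * b) = G (c + \<delta>)"
    using grd_snoc_less[of "m * b" e "[1, a, b, c, d]"] mb be by (simp add: G_def)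
  then have G_pt: "G (c + \<delta>) \<le> k + 2" using pt k by simp
  \<comment> \<open>The test amount \<open>c + \<delta>\<close> lies on the second or the third
    branch of \<open>G\<close>; either way the condition becomes a bound on
    \<open>\<delta>\<close>.\<close>
  have pt1: "\<delta> \<le> k + 1" if "c + \<delta> < d"
    using G_pt G_cd[of "c + \<delta>"] that by simp
  have pt2: "\<delta> + a \<le> k + 1 + b" if "d \<le> c + \<delta>"
    using G_pt G_de[of "c + \<delta>"] g_small[of "c + \<delta> - d"] that mb be d b by auto
  \<comment> \<open>Here \<open>c + i < d\<close>, so \<open>c + i\<close> costs
    \<open>i + 1\<close> coins and its predecessor by a coin \<open>b\<close> must cost at least
    \<open>i\<close>. The identity \<open>c + \<delta> = (k + 2) * b\<close> splits that predecessor
    into coins \<open>b\<close> and a small remainder.\<close>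
  have low_b: "i \<le> g (c + i - b)" if "i + a < b" for i
  proof (cases "\<delta> \<le> i")
    case True
    then have "c + i - b = (k + 1) * b + (i - \<delta>)"
      using c' by (simp add: algebra_simps)
    then have "g (c + i - b) = k + 1 + (i - \<delta>)"
      using g_mult[of "k + 1" "i - \<delta>"] g_small[of "i - \<delta>"] that b by auto
    then show ?thesis using True pt1 that d by simp
  next
    case False
    then have "c + i - b = k * b + (b + i - \<delta>)"
      using c' mb by (simp add: algebra_simps)
    then have "g (c + i - b) = k + g (b + i - \<delta>)"
      by (simp only: g_mult)
    moreover have "i \<le> k + g (b + i - \<delta>)"
    proof (cases "b + i - \<delta> < a")
      case True
      then show ?thesis using g_small mb by simp
    next
      case 2: False
      then have "g (b + i - \<delta>) + a = b + i - \<delta> + 1"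
        using False mb by (intro g_mid) auto
      then show ?thesis using 2 pt1 pt2 mb that d b by (cases "c + \<delta> < d") auto
    qed
    ultimately show ?thesis by simp
  qed
  \<comment> \<open>This follows from \<open>low_b\<close> by \<open>g_shift\<close>, except at
    \<open>i = a - 1\<close> with \<open>b = 2 * a - 1\<close>, which \<open>low_b\<close> does not
    reach.\<close>
  have low_a: "i \<le> g (c + i - a)" if "i < a" for i
  proof (cases "i + a < b")
    case True
    then show ?thesis
      using low_b[OF True] g_shift[of "c + i - b"] lt ab by simp
  next
    case False
    then have i: "i + 1 = a" "b + 1 = 2 * a" using that b by auto
    have "c + i - a = (k + 1) * b + (b - 1 - \<delta>)"
      using c' mb i by (simp add: algebra_simps)
    then have "g (c + i - a) = k + 1 + g (b - 1 - \<delta>)"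
      by (simp only: g_mult)
    moreover have "i \<le> k + 1 + g (b - 1 - \<delta>)"
    proof (cases "b - 1 - \<delta> < a")
      case True
      then show ?thesis using g_small pt1 pt2 mb i d by (cases "c + \<delta> < d") auto
    next
      case False
      then have "g (b - 1 - \<delta>) + a = b - 1 - \<delta> + 1"
        using mb by (intro g_mid) auto
      then show ?thesis using False pt1 pt2 mb i d by (cases "c + \<delta> < d") auto
    qed
    ultimately show ?thesis by simp
  qed
  have "orderly ([1, a, b, c, d] @ [e])"
  proof (rule orderly_snocI[OF cs])
    fix r x assume "x \<in> set [1, a, b, c, d]"
    then have x: "x \<in> {1, a, b, c, d}" by simp
    have "G (r + x) \<le> Suc (G r)" if "r + x < e"
    proof -
      \<comment> \<open>The cases record the branches of \<open>G\<close> on which \<open>r\<close>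
        and \<open>r + x\<close> lie. Crossing from below \<open>c\<close> (cases 2 and 3) is where
        \<open>low_a\<close> and \<open>low_b\<close> enter.\<close>
      consider (1) "r < c" "r + x < c" | (2) "r < c" "c \<le> r + x" "r + x < d"
        | (3) "r < c" "d \<le> r + x" | (4) "c \<le> r" "r < d" "r + x < d"
        | (5) "c \<le> r" "r < d" "d \<le> r + x" | (6) "d \<le> r"
        by linarith
      then show ?thesis
      proof cases
        case 1
        then have "x = 1 \<or> x = a \<or> x = b" using x ab by auto
        then show ?thesis using g_add g_b G_c 1 by auto
      next
        case 2
        have "r + x - c \<le> g r"
        proof -
          consider (x1) "x = 1" | (xa) "x = a" | (xb) "x = b" | (xc) "x = c" using x 2 by auto
          then show ?thesis
          proof cases
            case x1
            then show ?thesis using 2 by simp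
          next
            case xa
            then show ?thesis using low_a[of "r + a - c"] 2 ab d b by simp
          next
            case xb
            then show ?thesis using low_b[of "r + b - c"] 2 d by simp
          next
            case xc
            then show ?thesis using g_small[of r] 2 ab by simp
          qed
        qed
        then show ?thesis using G_c G_cd 2 by simp
      next
        case 3
        have "g (r + x - d) \<le> g r"
        proof -
          consider (x1) "x = 1" | (xa) "x = a" | (xb) "x = b" | (xc) "x = c" | (xd) "x = d"
            using x by auto
          then show ?thesis
          proof cases
            case x1
            then show ?thesis using 3 ab by simp
          next
            case xa
            then have "r + x - d = 0" using 3 ab d b by auto
            then show ?thesis using g_le[of 0] by simp
          next
            case xb
            then have "r = c + (r + x - d) - a" "r + x - d < a" using 3 d ab by linarith+
            then show ?thesis using low_a[of "r + x - d"] g_le[of "r + x - d"] by simp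
          next
            case xc
            then have "r = r + x - d + (b - a)" using 3 d ab by linarith
            then show ?thesis using g_shift[of "r + x - d"] by simp
          next
            case xd
            then show ?thesis by simp
          qed
        qed
        then show ?thesis using G_c G_de 3 that by simp
      next
        case 4
        then have "x = 1" using x lt ab d b by auto
        then show ?thesis using G_cd 4 by simp
      next
        case 5
        have "g (r + x - d) \<le> Suc (r - c)"
        proof -
          have "x \<noteq> c" "x \<noteq> d" using 5 that lt ab b d e by auto
          then consider (x1) "x = 1" | (xa) "x = a" | (xb) "x = b" using x by auto
          then show ?thesis
          proof cases
            case x1
            then show ?thesis using 5 g_le[of "r + x - d"] by simp
          next
            case xa
            then show ?thesis using 5 b d g_le[of "r + x - d"] by linarith
          next
            case xb
            then have "r + x - d = r - c + a" using 5 d ab by linarith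
            then show ?thesis using g_add[of a "r - c"] g_le[of "r - c"] by simp
          qed
        qed
        then show ?thesis using G_cd G_de 5 that by simp
      next
        case 6
        then have "x = 1 \<or> x = a \<or> x = b"
          using x that lt ab b d e by auto
        then have "g (r - d + x) \<le> Suc (g (r - d))"
          using g_add g_b by auto
        then show ?thesis using G_de 6 that by simp
      qed
    qed
    then show "grd [1, a, b, c, d] (r + x) \<le> Suc (grd [1, a, b, c, d] r)" if "r + x < e"
      using that by (simp only: G_def)
    have "G (r + x - e) \<le> G r" if "r < e" "e \<le> r + x"
    proof -
      consider (1) "r < c" | (2) "c \<le> r" "r < d" | (3) "d \<le> r" by linarith
      then show ?thesis
      proof cases
        case 1
        then have "x = c \<or> x = d" using x that lt ab b c e by auto
        then show ?thesis
        proof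
          assume "x = c"
          then have "r + x - e = 0" using 1 b e by linarith
          then show ?thesis by (simp add: G_def)
        next
          assume "x = d"
          then have "r = c + (r + x - e) - a" "r + x - e < a" using 1 d e that by linarith+
          then show ?thesis
            using low_a[of "r + x - e"] g_le[of "r + x - e"] G_c 1 c ab lt by simp
        qed
      next
        case 2
        then have "x \<noteq> 1" "x \<noteq> a" using that lt ab b c d e by auto
        then consider (xb) "x = b" | (xc) "x = c" | (xd) "x = d" using x by auto
        then show ?thesis
        proof cases
          case xb
          then have "r + x - e = 0" using 2 b c d e by linarith
          then show ?thesis by (simp add: G_def)
        next
          case xc
          then have "r + x - e \<le> Suc (r - c)" "r + x - e < c" using 2 b c d e lt ab by linarith+
          then show ?thesis using G_c[of "r + x - e"] g_le[of "r + x - e"] G_cd[of r] 2 by simp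
        next
          case xd
          then have "r + x - e = r - c + a" "r - c + a < c" using 2 b c d e lt ab by linarith+
          then show ?thesis
            using G_c[of "r - c + a"] g_add[of a "r - c"] g_le[of "r - c"] G_cd[of r] 2 by simp
        qed
      next
        case 3
        \<comment> \<open>\<open>t\<close> is left after the coin \<open>d\<close> in
          \<open>r\<close>, and \<open>y\<close> after the coin \<open>e\<close> in
          \<open>r + x\<close>; the goal becomes \<open>G y \<le> Suc (g t)\<close>.\<close>
        define t y where "t = r - d" and "y = r + x - e"
        have t: "r = d + t" "t + a < c" using 3 that d e by (simp_all add: t_def)
        have y: "t + d + x = e + y" using t that by (simp add: y_def)
        have "G y \<le> Suc (g t)"
        proof -
          consider "x = 1" | "x = a" | "x = b" | "x = c" | "x = d" using x by auto
          then show ?thesis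
          proof cases
            case 1
            then have "y = 0" using y t d e by linarith
            then show ?thesis by (simp add: G_def)
          next
            case 2
            then have "c + y - a = t + a" "y < a" using y t d e by linarith+
            then show ?thesis
              using low_a[of y] g_add[of a t] g_le[of y] G_c[of y] lt ab by simp
          next
            case 3
            then have ty: "c + y - a = t + b" "y < b" using y t d e by linarith+
            show ?thesis
            proof (cases "y < a")
              case True
              then show ?thesis
                using low_a[of y] g_b[of t] g_le[of y] G_c[of y] ty lt by simp
            next
              case False
              then have "t = c + (y - a) - b" using ty by linarith
              then show ?thesis
                using low_b[of "y - a"] g_mid[of y] G_c[of y] ty lt False by simp
            qed
          next
            case 4
            then have "y = t + a" using y d e by linarith
            then show ?thesis using g_add[of a t] G_c[of y] t by simp
          next
            case 5
            then have ty: "y = t + b" "y < d" using y t d e by linarith+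
            show ?thesis
            proof (cases "y < c")
              case True
              then show ?thesis using g_b[of t] G_c[of y] ty by simp
            next
              case False
              then show ?thesis
                using low_b[of "y - c"] G_cd[of y] ty d by simp
            qed
          qed
        qed
        then show ?thesis using G_de[of r] 3 that by (simp add: t_def y_def)
      qed
    qed
    then show "grd [1, a, b, c, d] (r + x - e) \<le> grd [1, a, b, c, d] r" if "r < e" "e \<le> r + x"
      using that by (simp only: G_def)
  qed simp
  then show ?thesis by simp
qed

section \<open>Sign patterns and the members with a failing prefix of length four\<close>

lemma pattern6:
  assumes "1 < a"
  shows "pattern [1, a, b, c, d, e] =
    [CHR ''+'', CHR ''+'',
     if orderly [1, a, b] then CHR ''+'' else CHR ''-'',
     if orderly [1, a, b, c] then CHR ''+'' else CHR ''-'',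
     if orderly [1, a, b, c, d] then CHR ''+'' else CHR ''-'',
     if orderly [1, a, b, c, d, e] then CHR ''+'' else CHR ''-'']"
  using orderly_1 orderly_1_2[OF assms] by (simp add: pattern_def upt_rec)

text \<open>Both one-point tests at the amount \<open>c + i\<close>, a multiple of \<open>b\<close>,
  in explicit form: the first count decides (1,a,b,c), the second is the condition on the whole
  system.\<close>

lemma grd_doubling_family:
  assumes lt: "1 < a" "b < c" and b: "b = 2 * a \<or> b + 1 = 2 * a" and c: "3 * a \<le> c + 1"
    and d: "d + a = b + c" and e: "e + 2 * a = b + 2 * c" and "i < b"
  shows "grd [1, a, b] i = (if i < a then i else i + 1 - a)"
    and "grd [1, a, b, c, d, e] (c + i) = (if c + i < d then Suc i else Suc (c + i - d))"
proof -
  have ab: "a < b" "c < d" "c + b \<le> e"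
    using lt b c d e by linarith+
  have small: "grd ([1] @ E) j = j" if "\<forall>x\<in>set E. j < x" for j E
    using grd_append_less[of E j "[1]"] that by (simp add: grd_def)
  show "grd [1, a, b] i = (if i < a then i else i + 1 - a)"
  proof (cases "i < a")
    case True
    then show ?thesis using small[of "[a, b]" i] ab by auto
  next
    case False
    then have "grd [1, a, b] i = Suc (grd [1, a] (i - a))"
      using grd_snoc_less[of i b "[1, a]"] grd_snoc_ge[of a i "[1]"] \<open>i < b\<close> lt by simp
    moreover have "i - a < a" using b \<open>i < b\<close> False by linarith
    ultimately show ?thesis using small[of "[a]" "i - a"] False by simp
  qed
  show "grd [1, a, b, c, d, e] (c + i) = (if c + i < d then Suc i else Suc (c + i - d))"
  proof (cases "c + i < d")
    case True
    then have "i < a" using d b ab by linarith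
    have "grd [1, a, b, c, d, e] (c + i) = Suc (grd [1, a, b, c] i)"
      using grd_append_less[of "[d, e]" "c + i" "[1, a, b, c]"] grd_snoc_ge[of c "c + i" "[1, a, b]"]
        ab \<open>i < b\<close> True lt by fastforce
    then show ?thesis using small[of "[a, b, c]" i] \<open>i < a\<close> ab lt True by auto
  next
    case False
    then have i: "c + i - d < a" using d \<open>i < b\<close> ab by linarith
    have "grd [1, a, b, c, d, e] (c + i) = Suc (grd [1, a, b, c, d] (c + i - d))"
      using grd_append_less[of "[e]" "c + i" "[1, a, b, c, d]"] grd_snoc_ge[of d "c + i" "[1, a, b, c]"]
        ab \<open>i < b\<close> False by auto
    then show ?thesis using small[of "[a, b, c, d]" "c + i - d"] i ab lt False by auto
  qed
qed

text \<open>The test remainder is at most 2 and hence costs at most one coin, while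
  \<open>3 < c\<close> makes \<open>m\<close> at least 2.\<close>

lemma orderly_1_2_3_c:
  assumes "3 < c"
  shows "orderly [1, 2, 3, c]"
proof -
  define m where "m = nat \<lceil>real c / real 3\<rceil>"
  have m: "c \<le> m * 3" "m * 3 < c + 3"
    using nat_ceiling_divide[of 3 c] by (simp_all add: m_def)
  then have "m * 3 - c = 0 \<or> m * 3 - c = 1 \<or> m * 3 - c = 2" by linarith
  then have "grd [1, 2, 3] (m * 3 - c) \<le> 1"
    by (elim disjE) (simp_all add: grd_def)
  then have "orderly ([1, 2] @ [3, c])"
    using assms m orderly3_doubleI[of 2 3]
    by (intro orderly_snoc_one_point[of _ _ _ m]) (simp_all add: coin_system_def)
  then show ?thesis by simp
qed

lemma not_orderly4_doubling_family:
  assumes lt: "1 < a" "b < c" and b: "b = 2 * a \<or> b + 1 = 2 * a" and c: "3 * a \<le> c + 1"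
    and d: "d + a = b + c" and e: "e + 2 * a = b + 2 * c"
    and ord: "orderly [1, a, b, c, d, e]" and nord: "\<not> orderly [1, a, b, c]"
  obtains m where "1 < m" "m < a" "b + 1 = 2 * a" "c + a = m * b + 1"
    | m where "1 < m" "m \<le> a" "b = 2 * a" "c + a + m = m * b + 1"
proof -
  have ab: "a < b" "c < d" "d < e" using lt b c d e by linarith+
  define m where "m = nat \<lceil>real c / real b\<rceil>"
  have m: "c \<le> m * b" "m * b < c + b"
    using nat_ceiling_divide[of b c] ab by (simp_all add: m_def)
  define i where "i = m * b - c"
  have i: "m * b = c + i" "i < b" using m by (simp_all add: i_def)
  note g = grd_doubling_family[OF lt b c d e i(2)]
  have "\<not> grd [1, a, b] i < m"
    using orderly_snoc_one_point[of "[1, a]" b c m] nord orderly3_doubleI[OF lt(1) b] m lt ab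
    by (auto simp: i_def coin_system_def)
  moreover have "grd [1, a, b, c, d, e] (c + i) \<le> m"
    using orderly_grd_mult[of "[1, a, b, c, d, e]" b m] ord i lt ab by (simp add: coin_system_def)
  \<comment> \<open>The short system fails at \<open>c + i\<close> and the long one passes. The
    explicit counts leave a single value of \<open>i\<close> for each of the two choices of
    \<open>b\<close>.\<close>
  ultimately have cases: "(b + 1 = 2 * a \<and> i + 1 = a \<and> m < a) \<or> (b = 2 * a \<and> i + 1 = m + a)"
    using g b d by (auto split: if_splits)
  have "1 < m"
  proof (rule ccontr)
    assume "\<not> 1 < m"
    then have "m * b \<le> 1 * b" by (intro mult_le_mono1) simp
    then show False using m lt by linarith
  qed
  from cases show ?thesis
  proof
    assume "b + 1 = 2 * a \<and> i + 1 = a \<and> m < a"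
    then show ?thesis using i \<open>1 < m\<close> by (intro that(1)[of m]) linarith+
  next
    assume "b = 2 * a \<and> i + 1 = m + a"
    then show ?thesis using i \<open>1 < m\<close> by (intro that(2)[of m]) linarith+
  qed
qed

text \<open>The multiple \<open>m * b\<close> passes the test of the doubling family and fails the
  test for (1,a,b,c). At length five the sum \<open>c + c\<close> violates the two-coin
  condition.\<close>

lemma not_orderly_subfamily:
  assumes a: "1 < m" and m: "m < a \<and> b + 1 = 2 * a \<and> c + a = m * b + 1 \<or>
      m \<le> a \<and> b = 2 * a \<and> c + a + m = m * b + 1"
    and d: "d + a = b + c" and e: "e + 2 * a = b + 2 * c"
  shows "orderly [1, a, b, c, d, e]" "\<not> orderly [1, a, b, c]" "\<not> orderly [1, a, b, c, d]"
proof -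
  have b: "b = 2 * a \<or> b + 1 = 2 * a" and "1 < a" using m a by auto
  define k where "k = m - 2"
  then have k: "m = k + 2" using a by simp
  have mb: "m * b = k * b + 2 * b" by (simp add: k algebra_simps)
  have "k * 3 \<le> k * b" using \<open>1 < a\<close> b by auto
  \<comment> \<open>The second fact excludes \<open>2 * c = d + b\<close> when
    \<open>b = 2 * a\<close>, because there
    \<open>2 * c - d = 2 * a - 1 + (k * b - k)\<close>.\<close>
  then have kb: "k \<le> k * b" "k * b \<noteq> k + 1"
    by (linarith, cases k) (simp, linarith)
  have c: "3 * a \<le> c + 1"
    using m mb kb \<open>1 < a\<close> k by linarith
  then have lt: "1 < a" "b < c"
    using \<open>1 < a\<close> m by linarith+
  define i where "i = m * b - c"
  have i: "m * b = c + i" "i < b"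
    using m a lt by (auto simp: i_def)
  note g = grd_doubling_family[OF lt b c d e i(2)]
  have ab: "a < b" "c < d" "d < e" using lt b c d e by linarith+
  have i': "m < a \<and> b + 1 = 2 * a \<and> i + 1 = a \<or> m \<le> a \<and> b = 2 * a \<and> i + 1 = m + a"
    using m i by auto
  have "grd [1, a, b, c, d, e] (m * b) \<le> m"
    using g(2) i i' d a by (auto split: if_splits)
  then show "orderly [1, a, b, c, d, e]"
    using orderly_doubling_family[OF lt b c d e, of m] i by simp
  have "\<not> grd [1, a, b] (m * b - c) < m"
    using g(1) i i' by (auto split: if_splits)
  then show "\<not> orderly [1, a, b, c]"
    using orderly_snoc_one_point_iff[of "[1, a]" b c m] orderly3_doubleI[OF lt(1) b] i lt ab
    by (auto simp: coin_system_def)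
  show "\<not> orderly [1, a, b, c, d]"
  proof
    assume "orderly [1, a, b, c, d]"
    then have "2 * c \<in> {d, d + 1, d + a, d + b, d + c, d + d}"
      using two_coins5(1)[of a b c d c c] lt ab d b by (auto simp flip: mult_2)
    then show False
      using m mb kb k d lt unfolding insert_iff empty_iff by linarith
  qed
qed

text \<open>Translates between equations free of subtraction and the explicit coins of the theorem.
  No subtraction is truncated, since \<open>a \<le> m * (2 * a - 1)\<close>.\<close>

lemma doubling_family_coins:
  fixes a b c d e m :: nat
  assumes "1 < a" "1 < m"
  shows "b + 1 = 2 * a \<and> c + a = m * b + 1 \<and> d + a = b + c \<and> e + 2 * a = b + 2 * c \<longleftrightarrow>
      [1, a, b, c, d, e] = [1, a, 2 * a - 1, m * (2 * a - 1) - (a - 1), m * (2 * a - 1),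
        (2 * m - 1) * (2 * a - 1)]"
    and "b = 2 * a \<and> c + a + m = m * b + 1 \<and> d + a = b + c \<and> e + 2 * a = b + 2 * c \<longleftrightarrow>
      [1, a, b, c, d, e] = [1, a, 2 * a, m * (2 * a - 1) - (a - 1), m * (2 * a - 1) + 1,
        (2 * m - 1) * (2 * a - 1) + 1]"
proof -
  define s where "s = 2 * a - 1"
  have s: "s + 1 = 2 * a" using assms by (simp add: s_def)
  have "(2 * m - 1) * s + 1 * s = 2 * m * s"
    using assms(2) by (simp only: flip: add_mult_distrib) simp
  moreover have "1 * s \<le> m * s"
    using assms(2) by (intro mult_le_mono1) simp
  moreover have "m * (2 * a) = m * s + m"
    by (simp flip: s)
  ultimately have ms: "(2 * m - 1) * s + s = 2 * (m * s)" "a \<le> m * s" "m * (2 * a) = m * s + m"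
    using s assms(1) by (simp_all add: mult.assoc)
  show "b + 1 = 2 * a \<and> c + a = m * b + 1 \<and> d + a = b + c \<and> e + 2 * a = b + 2 * c \<longleftrightarrow>
      [1, a, b, c, d, e] = [1, a, 2 * a - 1, m * (2 * a - 1) - (a - 1), m * (2 * a - 1),
        (2 * m - 1) * (2 * a - 1)]"
    unfolding s_def[symmetric] using s ms assms by (cases "b = s") auto
  show "b = 2 * a \<and> c + a + m = m * b + 1 \<and> d + a = b + c \<and> e + 2 * a = b + 2 * c \<longleftrightarrow>
      [1, a, b, c, d, e] = [1, a, 2 * a, m * (2 * a - 1) - (a - 1), m * (2 * a - 1) + 1,
        (2 * m - 1) * (2 * a - 1) + 1]"
    unfolding s_def[symmetric] using s ms assms by (cases "b = 2 * a") auto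
qed

section \<open>The characterization\<close>

text \<open>Families 2 and 3 determine their patterns. Family 1 does not, since the systems of
  family 2 also satisfy its conditions.\<close>

theorem theorem1p2:
  fixes C :: "nat list" and c2 c3 c4 c5 c6 :: nat
  assumes C: "C = [1, c2, c3, c4, c5, c6]"
    and coins: "coin_system C"
  shows
    "let family1 =
           ((\<exists>a\<ge>5. C = [1, 2, 3, a, a + 1, 2 * a])
          \<or> (\<exists>a b. a \<ge> 2 \<and> b \<ge> 3 * a - 1 \<and> b \<noteq> 3 * a
                 \<and> C = [1, a, 2 * a, b, b + a, 2 * b]
                 \<and> (let m = nat \<lceil>real b / real (2 * a)\<rceil> in grd C (2 * m * a) \<le> m))
          \<or> (\<exists>a b. a \<ge> 2 \<and> b \<ge> 3 * a - 1
                 \<and> C = [1, a, 2 * a - 1, b, b + a - 1, 2 * b - 1]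
                 \<and> (let m' = nat \<lceil>real b / real (2 * a - 1)\<rceil> in grd C (m' * (2 * a - 1)) \<le> m')));
         family2 =
           ((\<exists>a m. 1 < m \<and> m < a
                 \<and> C = [1, a, 2 * a - 1, m * (2 * a - 1) - (a - 1), m * (2 * a - 1),
                        (2 * m - 1) * (2 * a - 1)])
          \<or> (\<exists>a m. 1 < m \<and> m \<le> a
                 \<and> C = [1, a, 2 * a, m * (2 * a - 1) - (a - 1), m * (2 * a - 1) + 1,
                        (2 * m - 1) * (2 * a - 1) + 1]));
         family3 =
           (orderly [1, c2, c3, c4, c5]
          \<and> (let m = nat \<lceil>real c6 / real c5\<rceil> in grd C (m * c5) \<le> m));
         pattern1 = (pattern C = ''++++-+'');
         pattern2 = (pattern C = ''+++--+'');
         pattern3 = (pattern C = ''++++++'' \<or> pattern C = ''+++-++'')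
     in (orderly C \<longleftrightarrow> family1 \<or> family2 \<or> family3)
      \<and> (orderly C \<longleftrightarrow> pattern1 \<and> family1 \<or> pattern2 \<and> family2 \<or> pattern3 \<and> family3)
      \<and> (family2 \<longrightarrow> pattern2)
      \<and> (family3 \<longrightarrow> pattern3)"
proof -
  have lt: "1 < c2" "c2 < c3" "c3 < c4" "c4 < c5" "c5 < c6"
    using coins by (auto simp: C coin_system_def)
  define family1 where "family1 \<longleftrightarrow>
       (\<exists>a\<ge>5. C = [1, 2, 3, a, a + 1, 2 * a])
       \<or> (\<exists>a b. a \<ge> 2 \<and> b \<ge> 3 * a - 1 \<and> b \<noteq> 3 * a
              \<and> C = [1, a, 2 * a, b, b + a, 2 * b]
              \<and> (let m = nat \<lceil>real b / real (2 * a)\<rceil> in grd C (2 * m * a) \<le> m))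
       \<or> (\<exists>a b. a \<ge> 2 \<and> b \<ge> 3 * a - 1
              \<and> C = [1, a, 2 * a - 1, b, b + a - 1, 2 * b - 1]
              \<and> (let m' = nat \<lceil>real b / real (2 * a - 1)\<rceil> in grd C (m' * (2 * a - 1)) \<le> m'))"
  define family2 where "family2 \<longleftrightarrow>
       (\<exists>a m. 1 < m \<and> m < a
           \<and> C = [1, a, 2 * a - 1, m * (2 * a - 1) - (a - 1), m * (2 * a - 1),
                  (2 * m - 1) * (2 * a - 1)])
       \<or> (\<exists>a m. 1 < m \<and> m \<le> a
           \<and> C = [1, a, 2 * a, m * (2 * a - 1) - (a - 1), m * (2 * a - 1) + 1,
                  (2 * m - 1) * (2 * a - 1) + 1])"
  define family3 where "family3 \<longleftrightarrow> orderly [1, c2, c3, c4, c5]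
       \<and> (let m = nat \<lceil>real c6 / real c5\<rceil> in grd C (m * c5) \<le> m)"
  have family3: "family3 \<longleftrightarrow> orderly [1, c2, c3, c4, c5] \<and> orderly C"
    using orderly_iff_one_point[of "[1, c2, c3, c4]" c5 c6] coins
    by (auto simp: family3_def C Let_def)
  have doubling: "orderly C" if "c3 = 2 * c2 \<or> c3 + 1 = 2 * c2" "3 * c2 \<le> c4 + 1"
    "c5 + c2 = c3 + c4" "c6 + 2 * c2 = c3 + 2 * c4"
    "grd C (nat \<lceil>real c4 / real c3\<rceil> * c3) \<le> nat \<lceil>real c4 / real c3\<rceil>"
    using orderly_doubling_family[OF lt(1,3) that(1-4) nat_ceiling_divide] that(5) lt by (simp add: C)
  have family1: "orderly C" if family1
    using that[unfolded family1_def]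
  proof (elim disjE exE conjE)
    fix a assume "5 \<le> a" "C = [1, 2, 3, a, a + 1, 2 * a]"
    then show ?thesis using orderly_1_2_3_family by simp
  next
    fix a b :: nat
    assume "a \<ge> 2" "b \<ge> 3 * a - 1" "C = [1, a, 2 * a, b, b + a, 2 * b]"
      "let m = nat \<lceil>real b / real (2 * a)\<rceil> in grd C (2 * m * a) \<le> m"
    then show ?thesis
      by (intro doubling) (auto simp: C Let_def mult_ac)
  next
    fix a b :: nat
    assume *: "a \<ge> 2" "b \<ge> 3 * a - 1" "C = [1, a, 2 * a - 1, b, b + a - 1, 2 * b - 1]"
      "let m' = nat \<lceil>real b / real (2 * a - 1)\<rceil> in grd C (m' * (2 * a - 1)) \<le> m'"
    then have "c2 = a" "c3 = 2 * a - 1" "c4 = b" "c5 = b + a - 1" "c6 = 2 * b - 1"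
      by (simp_all add: C)
    then have eqs: "c3 + 1 = 2 * c2" "3 * c2 \<le> c4 + 1" "c5 + c2 = c3 + c4" "c6 + 2 * c2 = c3 + 2 * c4"
      using *(1,2) by linarith+
    show ?thesis
      using *(4) unfolding Let_def \<open>c3 = 2 * a - 1\<close>[symmetric] \<open>c4 = b\<close>[symmetric]
      by (intro doubling eqs disjI2)
  qed
  have family2: "orderly C \<and> \<not> orderly [1, c2, c3, c4] \<and> \<not> orderly [1, c2, c3, c4, c5]" if family2
  proof -
    have "\<exists>m>1. (m < c2 \<and> c3 + 1 = 2 * c2 \<and> c4 + c2 = m * c3 + 1 \<or>
        m \<le> c2 \<and> c3 = 2 * c2 \<and> c4 + c2 + m = m * c3 + 1) \<and>
        c5 + c2 = c3 + c4 \<and> c6 + 2 * c2 = c3 + 2 * c4"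
      using that[unfolded family2_def]
    proof (elim disjE exE conjE)
      fix a m
      assume m: "1 < m" "m < a" and "C = [1, a, 2 * a - 1, m * (2 * a - 1) - (a - 1), m * (2 * a - 1),
                  (2 * m - 1) * (2 * a - 1)]"
      moreover from this have "c2 = a" by (simp add: C)
      ultimately show ?thesis
        using doubling_family_coins(1)[OF lt(1) m(1), of c3 c4 c5 c6] unfolding C by blast
    next
      fix a m
      assume m: "1 < m" "m \<le> a" and "C = [1, a, 2 * a, m * (2 * a - 1) - (a - 1), m * (2 * a - 1) + 1,
                  (2 * m - 1) * (2 * a - 1) + 1]"
      moreover from this have "c2 = a" by (simp add: C)
      ultimately show ?thesis
        using doubling_family_coins(2)[OF lt(1) m(1), of c3 c4 c5 c6] unfolding C by blast
    qed
    then obtain m where "1 < m" "m < c2 \<and> c3 + 1 = 2 * c2 \<and> c4 + c2 = m * c3 + 1 \<or>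
        m \<le> c2 \<and> c3 = 2 * c2 \<and> c4 + c2 + m = m * c3 + 1"
      "c5 + c2 = c3 + c4" "c6 + 2 * c2 = c3 + 2 * c4"
      by blast
    from not_orderly_subfamily[OF this] show ?thesis
      unfolding C by blast
  qed
  have not5: "if orderly [1, c2, c3, c4] then family1 else family2"
    if ord: "orderly C" and nord5: "\<not> orderly [1, c2, c3, c4, c5]"
  proof -
    have grd_le: "grd C (k * c3) \<le> k" for k
      using orderly_grd_mult[OF coins ord, of c3 k] by (simp add: C)
    have not4: family2
      if fam: "c3 = 2 * c2 \<or> c3 + 1 = 2 * c2" "3 * c2 \<le> c4 + 1" "c5 + c2 = c3 + c4"
        "c6 + 2 * c2 = c3 + 2 * c4" and nord4: "\<not> orderly [1, c2, c3, c4]"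
      using not_orderly4_doubling_family[OF lt(1,3) fam ord[unfolded C] nord4]
    proof cases
      case (1 m)
      then show ?thesis
        using doubling_family_coins(1)[OF lt(1) 1(1), of c3 c4 c5 c6] fam(3,4)
        unfolding family2_def C by blast
    next
      case (2 m)
      then show ?thesis
        using doubling_family_coins(2)[OF lt(1) 2(1), of c3 c4 c5 c6] fam(3,4)
        unfolding family2_def C by blast
    qed
    have "orderly [1, c2, c3]"
      using orderly6_imp_orderly3 lt ord by (simp only: C)
    from orderly6_necessary[OF lt ord[unfolded C] this nord5] show ?thesis
    proof (elim disjE conjE)
      assume "c2 = 2" "c3 = 3" "5 \<le> c4" "c5 = c4 + 1" "c6 = 2 * c4"
      then show ?thesis
        using orderly_1_2_3_c[of c4] by (simp add: family1_def C)
    next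
      assume eqs: "c3 = 2 * c2" "3 * c2 \<le> c4 + 1" "c4 \<noteq> 3 * c2" "c5 = c4 + c2" "c6 = 2 * c4"
      have "C = [1, c2, 2 * c2, c4, c4 + c2, 2 * c4]" using eqs by (simp add: C)
      moreover have "let m = nat \<lceil>real c4 / real (2 * c2)\<rceil> in grd C (2 * m * c2) \<le> m"
        unfolding Let_def using grd_le[of "nat \<lceil>real c4 / real (2 * c2)\<rceil>"]
        by (simp only: eqs(1) mult_ac)
      moreover have "2 \<le> c2" "3 * c2 - 1 \<le> c4" using eqs lt by linarith+
      \<comment> \<open>This holds whatever the sign of the length-four prefix; \<open>not4\<close>
        is called only if that prefix fails. The same happens in the next case.\<close>
      ultimately have family1
        using eqs(3) unfolding family1_def by blast
      then show ?thesis using not4 eqs by simp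
    next
      assume eqs: "c3 + 1 = 2 * c2" "3 * c2 \<le> c4 + 1" "c5 + 1 = c4 + c2" "c6 + 1 = 2 * c4"
      then have c3: "c3 = 2 * c2 - 1" and "c5 = c4 + c2 - 1" "c6 = 2 * c4 - 1" by linarith+
      then have "C = [1, c2, 2 * c2 - 1, c4, c4 + c2 - 1, 2 * c4 - 1]" by (simp add: C)
      moreover have "let m' = nat \<lceil>real c4 / real (2 * c2 - 1)\<rceil> in grd C (m' * (2 * c2 - 1)) \<le> m'"
        unfolding Let_def using grd_le unfolding c3 by blast
      moreover have "2 \<le> c2" "3 * c2 - 1 \<le> c4" using eqs lt by linarith+
      ultimately have family1
        unfolding family1_def by blast
      then show ?thesis using not4 eqs by simp
    qed
  qed
  define o3 o4 o5 o6
    where "o3 = orderly [1, c2, c3]" and "o4 = orderly [1, c2, c3, c4]"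
      and "o5 = orderly [1, c2, c3, c4, c5]" and "o6 = orderly C"
  note o_defs = o3_def o4_def o5_def o6_def
  have pat: "pattern C = [CHR ''+'', CHR ''+'', if o3 then CHR ''+'' else CHR ''-'',
      if o4 then CHR ''+'' else CHR ''-'', if o5 then CHR ''+'' else CHR ''-'',
      if o6 then CHR ''+'' else CHR ''-'']"
    by (simp only: C pattern6[OF lt(1)] o_defs)
  have pattern1: "pattern C = ''++++-+'' \<longleftrightarrow> o3 \<and> o4 \<and> \<not> o5 \<and> o6"
    and pattern2: "pattern C = ''+++--+'' \<longleftrightarrow> o3 \<and> \<not> o4 \<and> \<not> o5 \<and> o6"
    and pattern3: "pattern C = ''++++++'' \<or> pattern C = ''+++-++'' \<longleftrightarrow> o3 \<and> o5 \<and> o6"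
    by (auto simp: pat)
  have "o6 \<longrightarrow> o3"
    unfolding o_defs C using orderly6_imp_orderly3[OF _ lt] by blast
  moreover have "family1 \<longrightarrow> o6"
    unfolding o_defs by (intro impI family1)
  moreover have "family2 \<longrightarrow> o6 \<and> \<not> o4 \<and> \<not> o5"
    unfolding o_defs by (intro impI family2)
  moreover have "family3 \<longleftrightarrow> o5 \<and> o6"
    unfolding o_defs by (rule family3)
  moreover have "o6 \<and> \<not> o5 \<longrightarrow> (if o4 then family1 else family2)"
    unfolding o_defs by (intro impI, elim conjE, rule not5)
  \<comment> \<open>With the signs abbreviated, the claim is a propositional consequence of the
    collected implications.\<close>
  ultimately have "(o6 \<longleftrightarrow> family1 \<or> family2 \<or> family3)
      \<and> (o6 \<longleftrightarrow> pattern C = ''++++-+'' \<and> family1 \<or> pattern C = ''+++--+'' \<and> family2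
          \<or> (pattern C = ''++++++'' \<or> pattern C = ''+++-++'') \<and> family3)
      \<and> (family2 \<longrightarrow> pattern C = ''+++--+'')
      \<and> (family3 \<longrightarrow> pattern C = ''++++++'' \<or> pattern C = ''+++-++'')"
    unfolding pattern1 pattern2 pattern3 by argo
  then show ?thesis
    unfolding family1_def family2_def family3_def o6_def Let_def .
qed

end
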